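(* (The $(q+1)$th Power Law.) Let $K$ be a nonarchimedean local field with residue field of cardinality $q$ and open unit ball $P$. For all $\beta>0$, $$Z(f,\mathbb{P}^1(K),\beta)=\left(Z\left(\tfrac{qf}{q+1},P,\beta\right)\right)^{q+1}$$ as an identity of (everywhere convergent) power series in $f$.
   Context: Field. $K$ is a nonarchimedean local field with canonical absolute value $|\cdot|$, closed unit ball (ring of integers) $R=\{x\in K:|x|\leq 1\}$, open unit ball (maximal ideal) $P=\{x\in K:|x|<1\}$, $q=\#(R/P)$, and $|\cdot|$ is normalized so that $|\pi|=q^{-1}$ for any generator $\pi$ of $P$. $\mu$ is the additive Haar measure on $K$ with $\mu(R)=1$. Projective line. $\mathbb{P}^1(K)$ is the set of classes $[x_0:x_1]$ of nonzero vectors $(x_0,x_1)\in K^2$ modulo scaling by $K^\times$, with the quotient topology. The spherical metric is $$\delta([x_0:x_1],[y_0:y_1])=\frac{|x_0y_1-x_1y_0|}{\max\{|x_0|,|x_1|\}\cdot\max\{|y_0|,|y_1|\}}.$$ The group $PGL_2(R)$ (the quotient of $GL_2(R)$ by its center $R^\times$) acts on $\mathbb{P}^1(K)$: the class of $\left(\begin{smallmatrix}a&b\\c&d\end{smallmatrix}\right)\in GL_2(R)$ sends $[x_0:x_1]$ to $[ax_0+bx_1:cx_0+dx_1]$. $\nu$ is the unique $PGL_2(R)$-invariant Borel probability measure on $\mathbb{P}^1(K)$. Partition functions. For $\beta>0$ set $Z_0(P,\beta)=Z_0(\mathbb{P}^1(K),\beta)=1$ and, for $N\geq 1$, $$Z_N(P,\beta)=\int_{P^N}\prod_{1\leq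 i<j\leq N}|x_i-x_j|^{\beta}\,d\mu^N,\qquad Z_N(\mathbb{P}^1(K),\beta)=\int_{(\mathbb{P}^1(K))^N}\prod_{1\leq i<j\leq N}\delta(x_i,x_j)^{\beta}\,d\nu^N,$$ where $\mu^N,\nu^N$ are product measures. These numbers lie in $[0,1]$. For $X=P$ or $X=\mathbb{P}^1(K)$, the grand canonical partition function is $$Z(f,X,\beta)=\sum_{N=0}^\infty Z_N(X,\beta)\frac{f^N}{N!}.$$ *)

theory Defs
  imports "HOL-Analysis.Analysis"
begin

section \<open>Nonarchimedean local fields\<close>

text \<open>
  Since \<open>absv x = dist x 0\<close>, nonnegativity and definiteness of \<open>absv\<close> are those of the metric, and
  the topology and Borel sets of the field are the ones induced by \<open>absv\<close>.
\<close>

class nonarch_valued_field = field + metric_space +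
  fixes absv :: "'a \<Rightarrow> real"
  assumes dist_absv: "dist x y = absv (x - y)"
    and absv_mult: "absv (x * y) = absv x * absv y"
    and absv_ultrametric: "absv (x + y) \<le> max (absv x) (absv y)"
begin

definition int_ring :: "'a set" where
  "int_ring = {x. absv x \<le> 1}"

definition max_ideal :: "'a set" where
  "max_ideal = {x. absv x < 1}"

definition residue_card :: "'a itself \<Rightarrow> nat" where
  "residue_card _ =
     card (int_ring // {(x, y). x \<in> int_ring \<and> y \<in> int_ring \<and> x - y \<in> max_ideal})"

end

text \<open>
  A nonarchimedean local field is a nondiscrete locally compact field whose topology is given by
  a nonarchimedean absolute value; any characteristic is allowed.  Completeness, discreteness of
  the value group, finiteness of the residue field and existence of a generator of the maximal
  ideal follow from local compactness.  The last axiom singles out the canonical absolute value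
  among its powers.
\<close>

class nonarch_local_field = nonarch_valued_field +
  assumes absv_nontrivial: "\<exists>x. x \<noteq> 0 \<and> absv x \<noteq> 1"
    and loc_compact: "\<exists>U C. open U \<and> x \<in> U \<and> U \<subseteq> C \<and> compact C"
    and absv_generator:
      "max_ideal = {\<pi> * r | r. r \<in> int_ring} \<Longrightarrow> absv \<pi> = 1 / real (residue_card TYPE('a))"

text \<open>
  \<open>K\<close> is second countable, so a Borel measure that is finite on compact sets is automatically
  regular.
\<close>

definition normalized_haar :: "'k::nonarch_local_field measure \<Rightarrow> bool" where
  "normalized_haar \<mu> \<longleftrightarrow>
     sets \<mu> = sets borel \<and>
     (\<forall>C. compact C \<longrightarrow> emeasure \<mu> C < \<infinity>) \<and>
     (\<forall>a. \<forall>S\<in>sets borel. emeasure \<mu> ((\<lambda>x. a + x) ` S) = emeasure \<mu> S) \<and>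
     emeasure \<mu> int_ring = 1"


section \<open>The projective line\<close>

definition proj_rel :: "'k::field ^ 2 \<Rightarrow> 'k ^ 2 \<Rightarrow> bool" where
  "proj_rel x y \<longleftrightarrow> x \<noteq> 0 \<and> y \<noteq> 0 \<and> (\<exists>c. c \<noteq> 0 \<and> y = c *s x)"

lemma proj_rel_refl: "x \<noteq> 0 \<Longrightarrow> proj_rel x x"
  unfolding proj_rel_def using vector_smult_lid[of x] one_neq_zero by metis

lemma part_equivp_proj_rel: "part_equivp (proj_rel :: 'k::field ^ 2 \<Rightarrow> _)"
proof (rule part_equivpI)
  show "\<exists>x::'k ^ 2. proj_rel x x"
  proof
    have "(axis 1 1 :: 'k ^ 2) \<noteq> 0" by (simp add: axis_eq_0_iff)
    then show "proj_rel (axis 1 1) (axis 1 1 :: 'k ^ 2)" by (rule proj_rel_refl)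
  qed
  show "symp (proj_rel :: 'k ^ 2 \<Rightarrow> _)"
  proof (rule sympI)
    fix x y :: "'k ^ 2" assume "proj_rel x y"
    then obtain c where c: "x \<noteq> 0" "y \<noteq> 0" "c \<noteq> 0" "y = c *s x"
      by (auto simp: proj_rel_def)
    then have "x = inverse c *s y" by (simp add: vector_smult_assoc)
    with c show "proj_rel y x"
      unfolding proj_rel_def using nonzero_imp_inverse_nonzero by blast
  qed
  show "transp (proj_rel :: 'k ^ 2 \<Rightarrow> _)"
  proof (rule transpI)
    fix x y z :: "'k ^ 2" assume "proj_rel x y" "proj_rel y z"
    then obtain c d where "x \<noteq> 0" "z \<noteq> 0" "c \<noteq> 0" "d \<noteq> 0" "z = (d * c) *s x"
      by (auto simp: proj_rel_def vector_smult_assoc)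
    then show "proj_rel x z" unfolding proj_rel_def using no_zero_divisors by blast
  qed
qed

text \<open>
  The homogeneous coordinates \<open>x\<^sub>0, x\<^sub>1\<close> are the components \<open>x $ 1, x $ 2\<close>.
\<close>

quotient_type (overloaded) 'k proj_line = "'k::field ^ 2" / partial: proj_rel
  morphisms rep_proj proj
  by (rule part_equivp_proj_rel)

text \<open>The quotient topology from the subspace of nonzero vectors.\<close>

instantiation proj_line :: ("{field, topological_space}") topological_space
begin

definition open_proj_line :: "'a proj_line set \<Rightarrow> bool" where
  "open_proj_line U \<longleftrightarrow> openin (top_of_set {x. x \<noteq> 0}) {x. x \<noteq> 0 \<and> proj x \<in> U}"

instance
proof
  show "open (UNIV :: 'a proj_line set)"
    unfolding open_proj_line_def by simp
next
  fix S T :: "'a proj_line set" assume "open S" "open T"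
  moreover have "{x. x \<noteq> 0 \<and> proj x \<in> S \<inter> T} =
      {x. x \<noteq> 0 \<and> proj x \<in> S} \<inter> {x. x \<noteq> 0 \<and> proj x \<in> T}" by auto
  ultimately show "open (S \<inter> T)"
    unfolding open_proj_line_def by (simp only: openin_Int)
next
  fix K :: "'a proj_line set set" assume "\<forall>S\<in>K. open S"
  then have "openin (top_of_set {x. x \<noteq> 0}) (\<Union>S\<in>K. {x. x \<noteq> 0 \<and> proj x \<in> S})"
    by (intro openin_Union) (force simp only: open_proj_line_def image_iff)
  moreover have "(\<Union>S\<in>K. {x. x \<noteq> 0 \<and> proj x \<in> S}) = {x. x \<noteq> 0 \<and> proj x \<in> \<Union>K}" by auto
  ultimately show "open (\<Union>K)" by (simp only: open_proj_line_def)
qed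

end

lemma absv_pos:
  assumes "(c::'k::nonarch_valued_field) \<noteq> 0" shows "absv c > 0"
proof -
  have "absv c = dist c 0" by (simp add: dist_absv)
  then show ?thesis using assms by simp
qed

lift_definition sph_dist :: "'k::nonarch_valued_field proj_line \<Rightarrow> 'k proj_line \<Rightarrow> real" is
  "\<lambda>x y. absv (x $ 1 * y $ 2 - x $ 2 * y $ 1) /
     (max (absv (x $ 1)) (absv (x $ 2)) * max (absv (y $ 1)) (absv (y $ 2)))"
proof -
  fix x x' y y' :: "'k ^ 2"
  assume "proj_rel x x'" "proj_rel y y'"
  then obtain c d where c: "c \<noteq> 0" "x' = c *s x" and d: "d \<noteq> 0" "y' = d *s y"
    by (auto simp: proj_rel_def)
  have mx: "max (absv a * u) (absv a * v) = absv a * max u v"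
    if "a \<noteq> 0" for a :: 'k and u v
    using absv_pos[OF that] by (simp add: max_mult_distrib_left)
  have "x' $ 1 * y' $ 2 - x' $ 2 * y' $ 1 = c * (d * (x $ 1 * y $ 2 - x $ 2 * y $ 1))"
    using c d by (simp add: algebra_simps)
  then have "absv (x' $ 1 * y' $ 2 - x' $ 2 * y' $ 1) =
      absv c * (absv d * absv (x $ 1 * y $ 2 - x $ 2 * y $ 1))"
    by (simp add: absv_mult)
  then show "absv (x $ 1 * y $ 2 - x $ 2 * y $ 1) /
      (max (absv (x $ 1)) (absv (x $ 2)) * max (absv (y $ 1)) (absv (y $ 2))) =
    absv (x' $ 1 * y' $ 2 - x' $ 2 * y' $ 1) /
      (max (absv (x' $ 1)) (absv (x' $ 2)) * max (absv (y' $ 1)) (absv (y' $ 2)))"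
    using absv_pos[OF c(1)] absv_pos[OF d(1)]
    by (simp add: c(2) d(2) absv_mult mx[OF c(1)] mx[OF d(1)] ac_simps del: mult_cancel_left)
qed

definition GL2_int :: "('k::nonarch_valued_field ^ 2 ^ 2) set" where
  "GL2_int = {A. (\<forall>i j. A $ i $ j \<in> int_ring) \<and>
     (\<exists>B. (\<forall>i j. B $ i $ j \<in> int_ring) \<and> A ** B = mat 1 \<and> B ** A = mat 1)}"

text \<open>
  The action is given on an arbitrary representative; for invertible \<open>A\<close> the choice does not
  matter, see \<open>proj_act_proj\<close>.  It factors through the quotient by the scalar matrices, so
  invariance under \<open>PGL\<^sub>2(R)\<close> is invariance under all \<open>proj_act A\<close> with \<open>A \<in> GL2_int\<close>.
\<close>

definition proj_act :: "'k::field ^ 2 ^ 2 \<Rightarrow> 'k proj_line \<Rightarrow> 'k proj_line" where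
  "proj_act A p = proj (A *v rep_proj p)"

lemma proj_act_proj:
  assumes A: "A \<in> GL2_int" and x: "x \<noteq> 0"
  shows "proj_act A (proj x) = proj (A *v x)"
proof -
  obtain B where B: "B ** A = mat 1" using A by (auto simp: GL2_int_def)
  have nz: "A *v z \<noteq> 0" if "z \<noteq> 0" for z
  proof
    assume "A *v z = 0"
    then have "(B ** A) *v z = 0" by (simp flip: matrix_vector_mul_assoc)
    with B that show False by simp
  qed
  have "proj_rel x x" using x by (rule proj_rel_refl)
  then have "proj_rel (rep_proj (proj x)) x"
    by (rule Quotient3_rep_abs[OF Quotient3_proj_line])
  then obtain c where c: "rep_proj (proj x) \<noteq> 0" "c \<noteq> 0" "x = c *s rep_proj (proj x)"
    unfolding proj_rel_def by blast
  have smult: "A *v (c *s z) = c *s (A *v z)" for z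
    by (simp add: vec_eq_iff matrix_vector_mult_def sum_distrib_left ac_simps)
  have "A *v x = c *s (A *v rep_proj (proj x))"
    using arg_cong[OF c(3), of "\<lambda>z. A *v z"] by (simp only: smult)
  then have "proj_rel (A *v rep_proj (proj x)) (A *v x)"
    using nz[OF c(1)] nz[OF x] c(2) unfolding proj_rel_def by blast
  then show ?thesis
    unfolding proj_act_def by (rule Quotient3_rel_abs[OF Quotient3_proj_line])
qed

definition invariant_prob :: "'k::nonarch_local_field proj_line measure \<Rightarrow> bool" where
  "invariant_prob \<nu> \<longleftrightarrow>
     sets \<nu> = sets borel \<and>
     emeasure \<nu> (space \<nu>) = 1 \<and>
     (\<forall>A\<in>GL2_int. \<forall>S\<in>sets borel. emeasure \<nu> (proj_act A ` S) = emeasure \<nu> S)"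


section \<open>Partition functions\<close>

definition Z_ball :: "'k::nonarch_local_field measure \<Rightarrow> real \<Rightarrow> nat \<Rightarrow> real" where
  "Z_ball \<mu> \<beta> N = (if N = 0 then 1 else
     (\<integral>x. (\<Prod>(i, j) \<in> {(i, j). 1 \<le> i \<and> i < j \<and> j \<le> N}. absv (x i - x j) powr \<beta>)
        \<partial>(Pi\<^sub>M {1..N} (\<lambda>_. restrict_space \<mu> max_ideal))))"

definition Z_line :: "'k::nonarch_local_field proj_line measure \<Rightarrow> real \<Rightarrow> nat \<Rightarrow> real" where
  "Z_line \<nu> \<beta> N = (if N = 0 then 1 else
     (\<integral>x. (\<Prod>(i, j) \<in> {(i, j). 1 \<le> i \<and> i < j \<and> j \<le> N}. sph_dist (x i) (x j) powr \<beta>)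
        \<partial>(Pi\<^sub>M {1..N} (\<lambda>_. \<nu>))))"

text \<open>
  The grand canonical partition function of a sequence of canonical ones, as a formal power series
  in the fugacity and as the function given by its sum.
\<close>

definition grand_fps :: "(nat \<Rightarrow> real) \<Rightarrow> complex fps" where
  "grand_fps Z = Abs_fps (\<lambda>N. complex_of_real (Z N) / fact N)"

definition grand_Z :: "(nat \<Rightarrow> real) \<Rightarrow> complex \<Rightarrow> complex" where
  "grand_Z Z f = (\<Sum>N. complex_of_real (Z N) * (f ^ N / fact N))"

end

theory Submission
  imports Defs
begin

text \<open>
  Reduction modulo \<open>P\<close> splits the projective line into \<open>q + 1\<close> balls.  Points in different balls have
  distance 1, so the integrand factors over the balls, and the number of ways to distribute \<open>N\<close>
  points among them turns the exponential generating function into a product.  Each ball is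
  isometric to \<open>P\<close>, and by uniqueness of Haar measure on \<open>P\<close> the measure \<open>\<nu>\<close> becomes
  \<open>q / (q + 1)\<close> times \<open>\<mu>\<close> there.
\<close>

section \<open>Iterated integrals of pair interactions\<close>

text \<open>Invariance of \<nu> is used through two kinds of integral matrices. Those that carry one
  residue ball to another force all q + 1 balls to have mass 1/(q + 1). The shears with parameter in
  P preserve the ball around [1 : 0] and translate its coordinate, and invariance under translation
  by P determines a finite measure on P up to a factor. Since \<mu>(P) = 1/q, this factor is (1/(q +
  1)) / (1/q) = q/(q + 1). Each of the N integrations contributes it once, so it can be absorbed
  into the fugacity f.

  The obstacle is that the integrand on N points does not factor before it is known which ball each
  point lies in, and that a point of the quotient has no preferred coordinates. Hence the charts
  also supply the measurability of \<open>sph_dist\<close> and its bound by 1. Integrals are taken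
  in \<open>ennreal\<close>, where integrability is not an issue and constants are kept in
  multiplied form. The uniform bound by 1 leads back to real numbers and also yields
  convergence.\<close>

text \<open>The weight \<open>w\<close> accumulates the interactions with the points that are already integrated.  In
  this form, splitting the space into non-interacting parts is an induction by Pascal's rule, with no
  reindexing of product measures.\<close>

primrec part_int :: "'a measure \<Rightarrow> ('a \<Rightarrow> 'a \<Rightarrow> ennreal) \<Rightarrow> nat \<Rightarrow> ('a \<Rightarrow> ennreal) \<Rightarrow> ennreal" where
  "part_int M k 0 w = 1"
| "part_int M k (Suc n) w = (\<integral>\<^sup>+x. w x * part_int M k n (\<lambda>y. w y * k y x) \<partial>M)"

text \<open>Each recursion step adds a point on which the weight depends, so the induction needs a
  parameter space that can absorb one more point without changing its type. Sequences in
  \<open>M\<close> do this.\<close>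

lemma measurable_part_int_stream:
  assumes "sigma_finite_measure M"
    and k[measurable]: "case_prod k \<in> borel_measurable (M \<Otimes>\<^sub>M M)"
    and "case_prod w \<in> borel_measurable (PiM UNIV (\<lambda>_::nat. M) \<Otimes>\<^sub>M M)"
  shows "(\<lambda>p. part_int M k n (w p)) \<in> borel_measurable (PiM UNIV (\<lambda>_::nat. M))"
  using assms(3)
proof (induction n arbitrary: w)
  case 0
  then show ?case by simp
next
  case (Suc n)
  interpret sigma_finite_measure M by fact
  note Suc.prems[measurable]
  \<comment> \<open>The newest point sits at position 0 and the older ones are shifted, so
    \<open>w'\<close> at \<open>case_nat x p\<close> is the weight \<open>w p\<close> updated by
    \<open>x\<close>.\<close>
  define w' where "w' = (\<lambda>(s :: nat \<Rightarrow> 'a) y. w (\<lambda>i. s (Suc i)) y * k y (s 0))"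
  have "case_prod w' \<in> borel_measurable (PiM UNIV (\<lambda>_::nat. M) \<Otimes>\<^sub>M M)"
  proof -
    have [measurable]: "(\<lambda>x i. fst x (Suc i)) \<in> measurable (PiM UNIV (\<lambda>_::nat. M) \<Otimes>\<^sub>M M) (PiM UNIV (\<lambda>_. M))"
      by (rule measurable_PiM_single') (auto simp: space_pair_measure space_PiM)
    show ?thesis unfolding w'_def by measurable
  qed
  from Suc.IH[OF this]
  have [measurable]: "(\<lambda>p. part_int M k n (w' p)) \<in> borel_measurable (PiM UNIV (\<lambda>_::nat. M))" .
  have "(\<lambda>(p, x). part_int M k n (w' (case_nat x p))) \<in>
      borel_measurable (PiM UNIV (\<lambda>_::nat. M) \<Otimes>\<^sub>M M)"
    by measurable
  then have [measurable]: "(\<lambda>(p, x). part_int M k n (\<lambda>y. w p y * k y x)) \<in>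
      borel_measurable (PiM UNIV (\<lambda>_::nat. M) \<Otimes>\<^sub>M M)"
    by (simp add: w'_def)
  show ?case by simp
qed

lemma measurable_part_int:
  assumes "sigma_finite_measure M"
    and k[measurable]: "case_prod k \<in> borel_measurable (M \<Otimes>\<^sub>M M)"
    and w[measurable]: "w \<in> borel_measurable M"
  shows "(\<lambda>x. part_int M k n (\<lambda>y. w y * k y x)) \<in> borel_measurable M"
proof -
  have "(\<lambda>(p, y). w y * k y (p 0)) \<in> borel_measurable (PiM UNIV (\<lambda>_::nat. M) \<Otimes>\<^sub>M M)"
    by measurable
  from measurable_part_int_stream[OF assms(1,2) this]
  have [measurable]: "(\<lambda>p. part_int M k n (\<lambda>y. w y * k y (p 0))) \<in>
      borel_measurable (PiM UNIV (\<lambda>_::nat. M))" .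
  \<comment> \<open>A single parameter is embedded as a constant sequence, of which only entry 0 is
    read.\<close>
  have [measurable]: "(\<lambda>x (i::nat). x) \<in> measurable M (PiM UNIV (\<lambda>_. M))"
    by (rule measurable_PiM_single') auto
  have "(\<lambda>x. part_int M k n (\<lambda>y. w y * k y ((\<lambda>i::nat. x) 0))) \<in> borel_measurable M"
    by (rule measurable_compose[where g = "\<lambda>p. part_int M k n (\<lambda>y. w y * k y (p 0))" and f = "\<lambda>x i. x"]) measurable
  then show ?thesis by simp
qed

section \<open>Product integrals as iterated integrals\<close>

lemma part_int_cong:
  "(\<And>x. x \<in> space M \<Longrightarrow> w x = w' x) \<Longrightarrow> part_int M k n w = part_int M k n w'"
proof (induction n arbitrary: w w')
  case (Suc n)
  then show ?case
    unfolding part_int.simps by (intro nn_integral_cong arg_cong2[where f = "(*)"] Suc.IH) auto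
qed simp

text \<open>The outermost integral belongs to the largest index. Its interactions with the remaining
  points are the factors \<open>k (x i) y\<close>, which the next weight absorbs; this fixes the
  argument order \<open>k y x\<close> in \<open>part_int\<close>, and \<open>k\<close> may be
  asymmetric.\<close>

lemma PiM_nn_integral_eq_part_int:
  fixes k :: "'a \<Rightarrow> 'a \<Rightarrow> ennreal"
  assumes "sigma_finite_measure M"
    and k[measurable]: "case_prod k \<in> borel_measurable (M \<Otimes>\<^sub>M M)"
    and w: "w \<in> borel_measurable M"
  shows "(\<integral>\<^sup>+x. (\<Prod>i\<in>{1..n}. w (x i)) * (\<Prod>(i, j)\<in>{(i, j). 1 \<le> i \<and> i < j \<and> j \<le> n}. k (x i) (x j))
    \<partial>PiM {1..n} (\<lambda>_. M)) = part_int M k n w"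
  using w
proof (induction n arbitrary: w)
  case 0
  have "{(i::nat, j). 1 \<le> i \<and> i < j \<and> j \<le> 0} = {}" "{1..0::nat} = {}" by auto
  then show ?case by (simp only: PiM_empty) (simp add: emeasure_count_space)
next
  case (Suc n)
  interpret sigma_finite_measure M by fact
  interpret product_sigma_finite "\<lambda>_::nat. M" by unfold_locales
  note [measurable] = Suc.prems
  let ?D = "\<lambda>n. {(i::nat, j). 1 \<le> i \<and> i < j \<and> j \<le> n}"
  have fin: "finite (?D n)" for n by (rule finite_subset[of _ "{..n} \<times> {..n}"]) auto
  have D: "?D (Suc n) = ?D n \<union> (\<lambda>i. (i, Suc n)) ` {1..n}" by auto
  have prodD: "(\<Prod>(i, j)\<in>?D (Suc n). g i j) = (\<Prod>(i, j)\<in>?D n. g i j) * (\<Prod>i\<in>{1..n}. g i (Suc n))"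
    for g :: "nat \<Rightarrow> nat \<Rightarrow> ennreal"
    unfolding D by (subst prod.union_disjoint) (auto simp: fin prod.reindex inj_on_def simp del: One_nat_def)
  have meas: "(\<lambda>x. (\<Prod>i\<in>{1..Suc n}. w (x i)) * (\<Prod>(i, j)\<in>?D (Suc n). k (x i) (x j)))
      \<in> borel_measurable (PiM (insert (Suc n) {1..n}) (\<lambda>_. M))"
  proof -
    have "(\<lambda>x. k (x i) (x j)) \<in> borel_measurable (PiM (insert (Suc n) {1..n}) (\<lambda>_. M))"
      if "(i, j) \<in> ?D (Suc n)" for i j
    proof -
      have "i \<in> insert (Suc n) {1..n}" "j \<in> insert (Suc n) {1..n}" using that by auto
      then show ?thesis by measurable
    qed
    moreover have "(\<lambda>x. w (x i)) \<in> borel_measurable (PiM (insert (Suc n) {1..n}) (\<lambda>_. M))"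
      if "i \<in> {1..Suc n}" for i
    proof -
      have "i \<in> insert (Suc n) {1..n}" using that by auto
      then show ?thesis by measurable
    qed
    ultimately show ?thesis
      by (intro borel_measurable_times_ennreal borel_measurable_prod_ennreal) (auto split: prod.split)
  qed
  have "(\<integral>\<^sup>+x. (\<Prod>i\<in>{1..Suc n}. w (x i)) * (\<Prod>(i, j)\<in>?D (Suc n). k (x i) (x j)) \<partial>PiM {1..Suc n} (\<lambda>_. M))
    = (\<integral>\<^sup>+y. (\<integral>\<^sup>+x. (\<Prod>i\<in>{1..Suc n}. w ((x(Suc n := y)) i)) *
        (\<Prod>(i, j)\<in>?D (Suc n). k ((x(Suc n := y)) i) ((x(Suc n := y)) j)) \<partial>PiM {1..n} (\<lambda>_. M)) \<partial>M)"
    using product_nn_integral_insert_rev[OF _ _ meas] by (simp add: atLeastAtMostSuc_conv)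
  also have "\<dots> = (\<integral>\<^sup>+y. (\<integral>\<^sup>+x. w y * ((\<Prod>i\<in>{1..n}. w (x i) * k (x i) y) *
        (\<Prod>(i, j)\<in>?D n. k (x i) (x j))) \<partial>PiM {1..n} (\<lambda>_. M)) \<partial>M)"
  proof (intro nn_integral_cong, goal_cases)
    case (1 y x)
    have "(\<Prod>(i, j)\<in>?D n. k ((x(Suc n := y)) i) ((x(Suc n := y)) j)) = (\<Prod>(i, j)\<in>?D n. k (x i) (x j))"
      by (rule prod.cong) auto
    moreover have "(\<Prod>i\<in>{1..n}. k ((x(Suc n := y)) i) y) = (\<Prod>i\<in>{1..n}. k (x i) y)"
      by (rule prod.cong) auto
    moreover have "(\<Prod>i\<in>{1..n}. w ((x(Suc n := y)) i)) = (\<Prod>i\<in>{1..n}. w (x i))"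
      by (rule prod.cong) auto
    ultimately show ?case
      unfolding prodD by (simp add: prod.distrib ac_simps)
  qed
  also have "\<dots> = (\<integral>\<^sup>+y. w y * (\<integral>\<^sup>+x. (\<Prod>i\<in>{1..n}. w (x i) * k (x i) y) *
        (\<Prod>(i, j)\<in>?D n. k (x i) (x j)) \<partial>PiM {1..n} (\<lambda>_. M)) \<partial>M)"
  proof (intro nn_integral_cong nn_integral_cmult, goal_cases)
    case (1 y)
    then have ky: "(\<lambda>x. k x y) \<in> borel_measurable M" by measurable
    have "(\<lambda>x. k (x i) (x j)) \<in> borel_measurable (PiM {1..n} (\<lambda>_. M))" if "(i, j) \<in> ?D n" for i j
    proof -
      have "i \<in> {1..n}" "j \<in> {1..n}" using that by auto
      then show ?thesis by measurable
    qed
    moreover have "(\<lambda>x. w (x i)) \<in> borel_measurable (PiM {1..n} (\<lambda>_. M))"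
      "(\<lambda>x. k (x i) y) \<in> borel_measurable (PiM {1..n} (\<lambda>_. M))" if "i \<in> {1..n}" for i
      by (rule measurable_compose[OF measurable_component_singleton[OF that]], fact)+
    ultimately show ?case
      by (intro borel_measurable_times_ennreal borel_measurable_prod_ennreal) (auto split: prod.split)
  qed
  also have "\<dots> = part_int M k (Suc n) w"
    unfolding part_int.simps
  proof (intro nn_integral_cong arg_cong2[where f = "(*)"] refl Suc.IH, goal_cases)
    case (1 y)
    then show ?case by measurable
  qed
  finally show ?case .
qed

text \<open>The Leibniz rule for a product of exponential generating functions, read at one
  coefficient: shifting a sequence by \<open>Suc\<close> differentiates its generating
  function.\<close>

lemma binomial_convolution_Suc:
  fixes a b :: "nat \<Rightarrow> 'a::comm_semiring_1"
  shows "(\<Sum>i\<le>n. of_nat (n choose i) * (a (Suc i) * b (n - i))) +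
      (\<Sum>i\<le>n. of_nat (n choose i) * (a i * b (Suc (n - i)))) =
    (\<Sum>i\<le>Suc n. of_nat (Suc n choose i) * (a i * b (Suc n - i)))"
proof -
  have "(\<Sum>i\<le>Suc n. of_nat (Suc n choose i) * (a i * b (Suc n - i))) =
      a 0 * b (Suc n) + (\<Sum>i\<le>n. of_nat (n choose i) * (a (Suc i) * b (n - i))) +
      (\<Sum>i\<le>n. of_nat (n choose Suc i) * (a (Suc i) * b (n - i)))"
    by (subst sum.atMost_Suc_shift) (simp add: algebra_simps sum.distrib)
  moreover have "(\<Sum>i\<le>n. of_nat (n choose i) * (a i * b (Suc (n - i)))) =
      (\<Sum>i\<le>Suc n. of_nat (n choose i) * (a i * b (Suc n - i)))"
    by (simp add: Suc_diff_le binomial_eq_0)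
  then have "(\<Sum>i\<le>n. of_nat (n choose i) * (a i * b (Suc (n - i)))) =
      a 0 * b (Suc n) + (\<Sum>i\<le>n. of_nat (n choose Suc i) * (a (Suc i) * b (n - i)))"
    unfolding sum.atMost_Suc_shift[of _ n] by (simp add: binomial_eq_0)
  ultimately show ?thesis by (simp add: ac_simps)
qed

text \<open>The outermost point lies in \<open>S\<close> or in \<open>T\<close>. It changes the
  weight only on its own side, because its interactions with the other side are 1; so one of the two
  partition functions moves up by one point and the other is untouched. The two cases are the two
  sums of \<open>binomial_convolution_Suc\<close>. The weight must be arbitrary, as the recursion
  changes it.\<close>

lemma part_int_Un:
  assumes sf: "sigma_finite_measure M"
    and k[measurable]: "case_prod k \<in> borel_measurable (M \<Otimes>\<^sub>M M)"
    and S[measurable]: "S \<in> sets M" and T[measurable]: "T \<in> sets M" and "S \<inter> T = {}"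
    and one: "\<And>x y. x \<in> S \<Longrightarrow> y \<in> T \<Longrightarrow> k x y = 1 \<and> k y x = 1"
    and "w \<in> borel_measurable M"
  shows "part_int M k n (\<lambda>x. w x * indicator (S \<union> T) x) =
    (\<Sum>i\<le>n. of_nat (n choose i) *
      (part_int M k i (\<lambda>x. w x * indicator S x) * part_int M k (n - i) (\<lambda>x. w x * indicator T x)))"
  using assms(7)
proof (induction n arbitrary: w)
  case 0
  then show ?case by simp
next
  case (Suc n)
  note [measurable] = Suc.prems
  let ?a = "\<lambda>i w. part_int M k i (\<lambda>x. w x * indicator S x)"
  let ?b = "\<lambda>i w. part_int M k i (\<lambda>x. w x * indicator T x)"
  let ?k = "\<lambda>x y. w y * k y x"
  have mA[measurable]: "(\<lambda>x. ?a i (?k x)) \<in> borel_measurable M" for i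
  proof -
    have "(\<lambda>x. w x * indicator S x) \<in> borel_measurable M" by measurable
    from measurable_part_int[OF sf k this] show ?thesis by (simp add: ac_simps)
  qed
  have mB[measurable]: "(\<lambda>x. ?b i (?k x)) \<in> borel_measurable M" for i
  proof -
    have "(\<lambda>x. w x * indicator T x) \<in> borel_measurable M" by measurable
    from measurable_part_int[OF sf k this] show ?thesis by (simp add: ac_simps)
  qed
  have IH: "part_int M k n (\<lambda>y. w y * indicator (S \<union> T) y * k y x) =
      (\<Sum>i\<le>n. of_nat (n choose i) * (?a i (?k x) * ?b (n - i) (?k x)))" if "x \<in> space M" for x
  proof -
    have "?k x \<in> borel_measurable M" using that by measurable
    from Suc.IH[OF this] show ?thesis by (simp add: ac_simps)
  qed
  \<comment> \<open>A point of \<open>T\<close> leaves the weight on \<open>S\<close> unchanged, and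
    conversely. These factors then no longer depend on \<open>x\<close> and leave the
    integral.\<close>
  have aT: "?a i (?k x) = ?a i w" if "x \<in> T" for i x
    by (intro part_int_cong) (auto simp: indicator_def one that)
  have bS: "?b i (?k x) = ?b i w" if "x \<in> S" for i x
    by (intro part_int_cong) (auto simp: indicator_def one that)
  have ind: "w x * indicator (S \<union> T) x * c = w x * indicator S x * c + w x * indicator T x * c" for x c
    using \<open>S \<inter> T = {}\<close> by (auto simp: indicator_def)
  have "part_int M k (Suc n) (\<lambda>x. w x * indicator (S \<union> T) x) =
    (\<integral>\<^sup>+x. (\<Sum>i\<le>n. of_nat (n choose i) * ((w x * indicator S x * ?a i (?k x)) * ?b (n - i) w)) +
      (\<Sum>i\<le>n. of_nat (n choose i) * (?a i w * (w x * indicator T x * ?b (n - i) (?k x)))) \<partial>M)"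
    unfolding part_int.simps
  proof (intro nn_integral_cong, goal_cases)
    case (1 x)
    have "w x * indicator S x * (\<Sum>i\<le>n. of_nat (n choose i) * (?a i (?k x) * ?b (n - i) (?k x))) =
      (\<Sum>i\<le>n. of_nat (n choose i) * ((w x * indicator S x * ?a i (?k x)) * ?b (n - i) w))"
    proof (cases "x \<in> S")
      case True
      show ?thesis unfolding bS[OF True] by (simp add: sum_distrib_left ac_simps)
    qed simp
    moreover have "w x * indicator T x * (\<Sum>i\<le>n. of_nat (n choose i) * (?a i (?k x) * ?b (n - i) (?k x))) =
      (\<Sum>i\<le>n. of_nat (n choose i) * (?a i w * (w x * indicator T x * ?b (n - i) (?k x))))"
    proof (cases "x \<in> T")
      case True
      show ?thesis unfolding aT[OF True] by (simp add: sum_distrib_left ac_simps)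
    qed simp
    ultimately show ?case by (subst IH[OF 1], subst ind) (simp only:)
  qed
  also have "\<dots> = (\<Sum>i\<le>n. of_nat (n choose i) * ((\<integral>\<^sup>+x. w x * indicator S x * ?a i (?k x) \<partial>M) * ?b (n - i) w)) +
      (\<Sum>i\<le>n. of_nat (n choose i) * (?a i w * (\<integral>\<^sup>+x. w x * indicator T x * ?b (n - i) (?k x) \<partial>M)))"
    by (simp add: nn_integral_add nn_integral_sum nn_integral_cmult nn_integral_multc)
  also have "(\<lambda>i. \<integral>\<^sup>+x. w x * indicator S x * ?a i (?k x) \<partial>M) = (\<lambda>i. ?a (Suc i) w)"
    by (simp add: ac_simps)
  also have "(\<lambda>i. \<integral>\<^sup>+x. w x * indicator T x * ?b i (?k x) \<partial>M) = (\<lambda>i. ?b (Suc i) w)"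
    by (simp add: ac_simps)
  also have "(\<Sum>i\<le>n. of_nat (n choose i) * (?a (Suc i) w * ?b (n - i) w)) +
      (\<Sum>i\<le>n. of_nat (n choose i) * (?a i w * ?b (Suc (n - i)) w)) =
    (\<Sum>i\<le>Suc n. of_nat (Suc n choose i) * (?a i w * ?b (Suc n - i) w))"
    by (rule binomial_convolution_Suc)
  finally show ?case .
qed

text \<open>Change of variables one point at a time. Hypothesis \<open>int\<close> says that
  \<open>M\<close> restricted to \<open>B\<close> is \<open>a\<close> times the image of
  \<open>L\<close> under \<phi>; it is used once for each of the \<open>n\<close>
  integrations.\<close>

lemma part_int_chart:
  fixes \<phi> :: "'a \<Rightarrow> 'b"
  assumes M: "sigma_finite_measure M" and L: "sigma_finite_measure L"
    and k[measurable]: "case_prod k \<in> borel_measurable (M \<Otimes>\<^sub>M M)"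
    and l: "case_prod l \<in> borel_measurable (L \<Otimes>\<^sub>M L)"
    and phi[measurable]: "\<phi> \<in> measurable L M"
    and int: "\<And>f. f \<in> borel_measurable M \<Longrightarrow>
      (\<integral>\<^sup>+x. f x * indicator B x \<partial>M) = a * (\<integral>\<^sup>+x. f (\<phi> x) \<partial>L)"
    and B: "B \<in> sets M"
    and kl: "\<And>x y. x \<in> space L \<Longrightarrow> y \<in> space L \<Longrightarrow> k (\<phi> x) (\<phi> y) = l x y"
    and "w \<in> borel_measurable M"
  shows "part_int M k n (\<lambda>x. w x * indicator B x) = a ^ n * part_int L l n (\<lambda>x. w (\<phi> x))"
  using assms(9)
proof (induction n arbitrary: w)
  case 0
  then show ?case by simp
next
  case (Suc n)
  note [measurable] = Suc.prems B
  have m: "(\<lambda>x. part_int M k n (\<lambda>y. w y * k y x * indicator B y)) \<in> borel_measurable M"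
  proof -
    have "(\<lambda>x. w x * indicator B x) \<in> borel_measurable M" by measurable
    from measurable_part_int[OF M k this] show ?thesis by (simp add: ac_simps)
  qed
  have m': "(\<lambda>x. part_int L l n (\<lambda>y. w (\<phi> y) * l y x)) \<in> borel_measurable L"
    by (rule measurable_part_int[OF L l]) measurable
  have "part_int M k (Suc n) (\<lambda>x. w x * indicator B x) =
    (\<integral>\<^sup>+x. (w x * part_int M k n (\<lambda>y. w y * k y x * indicator B y)) * indicator B x \<partial>M)"
    by (simp add: ac_simps)
  also have "\<dots> = a * (\<integral>\<^sup>+x. w (\<phi> x) * part_int M k n (\<lambda>y. w y * k y (\<phi> x) * indicator B y) \<partial>L)"
    by (rule int) (use m in measurable)
  also have "\<dots> = a * (\<integral>\<^sup>+x. a ^ n * (w (\<phi> x) * part_int L l n (\<lambda>y. w (\<phi> y) * l y x)) \<partial>L)"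
  proof (rule arg_cong[where f = "(*) a"], rule nn_integral_cong, goal_cases)
    case (1 x)
    have "\<phi> x \<in> space M" using measurable_space[OF phi 1] .
    then have "(\<lambda>y. w y * k y (\<phi> x)) \<in> borel_measurable M" by measurable
    from Suc.IH[OF this]
    have "part_int M k n (\<lambda>y. w y * k y (\<phi> x) * indicator B y) =
        a ^ n * part_int L l n (\<lambda>y. w (\<phi> y) * k (\<phi> y) (\<phi> x))" .
    also have "part_int L l n (\<lambda>y. w (\<phi> y) * k (\<phi> y) (\<phi> x)) = part_int L l n (\<lambda>y. w (\<phi> y) * l y x)"
      using 1 by (intro part_int_cong) (simp add: kl)
    finally have "part_int M k n (\<lambda>y. w y * k y (\<phi> x) * indicator B y) =
        a ^ n * part_int L l n (\<lambda>y. w (\<phi> y) * l y x)" .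
    then show ?case by (simp only: mult.left_commute)
  qed
  also have "\<dots> = a ^ Suc n * part_int L l (Suc n) (\<lambda>x. w (\<phi> x))"
    using m' by (subst nn_integral_cmult) (auto simp: ac_simps)
  finally show ?case .
qed

section \<open>Real values and generating functions\<close>

lemma part_int_le_1:
  assumes "emeasure M (space M) \<le> 1"
    and k: "\<And>x y. x \<in> space M \<Longrightarrow> y \<in> space M \<Longrightarrow> k x y \<le> 1"
    and "\<And>x. x \<in> space M \<Longrightarrow> w x \<le> 1"
  shows "part_int M k n w \<le> 1"
  using assms(3)
proof (induction n arbitrary: w)
  case 0
  then show ?case by simp
next
  case (Suc n)
  have le: "part_int M k n (\<lambda>y. w y * k y x) \<le> 1" if "x \<in> space M" for x
    using k that Suc.prems by (intro Suc.IH mult_le_one) auto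
  have "part_int M k (Suc n) w \<le> (\<integral>\<^sup>+x. 1 \<partial>M)"
    unfolding part_int.simps by (intro nn_integral_mono mult_le_one Suc.prems le) auto
  also have "\<dots> \<le> 1" using assms(1) by simp
  finally show ?case .
qed

lemma integral_PiM_eq_part_int:
  fixes k :: "'a \<Rightarrow> 'a \<Rightarrow> real"
  assumes M: "sigma_finite_measure M" and k[measurable]: "case_prod k \<in> borel_measurable (M \<Otimes>\<^sub>M M)"
    and nonneg: "\<And>x y. 0 \<le> k x y"
  shows "(\<integral>x. (\<Prod>(i, j)\<in>{(i, j). 1 \<le> i \<and> i < j \<and> j \<le> n}. k (x i) (x j)) \<partial>PiM {1..n} (\<lambda>_. M)) =
    enn2real (part_int M (\<lambda>x y. ennreal (k x y)) n (\<lambda>_. 1))"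
proof -
  let ?D = "{(i::nat, j). 1 \<le> i \<and> i < j \<and> j \<le> n}"
  have "(\<lambda>x. k (x i) (x j)) \<in> borel_measurable (PiM {1..n} (\<lambda>_. M))" if "(i, j) \<in> ?D" for i j
  proof -
    have "i \<in> {1..n}" "j \<in> {1..n}" using that by auto
    then show ?thesis by measurable
  qed
  then have "(\<lambda>x. \<Prod>(i, j)\<in>?D. k (x i) (x j)) \<in> borel_measurable (PiM {1..n} (\<lambda>_. M))"
    by (intro borel_measurable_prod) (auto split: prod.split)
  then have "(\<integral>x. (\<Prod>(i, j)\<in>?D. k (x i) (x j)) \<partial>PiM {1..n} (\<lambda>_. M)) =
      enn2real (\<integral>\<^sup>+x. ennreal (\<Prod>(i, j)\<in>?D. k (x i) (x j)) \<partial>PiM {1..n} (\<lambda>_. M))"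
    using nonneg by (intro integral_eq_nn_integral AE_I2) (auto intro!: prod_nonneg split: prod.split)
  also have "(\<integral>\<^sup>+x. ennreal (\<Prod>(i, j)\<in>?D. k (x i) (x j)) \<partial>PiM {1..n} (\<lambda>_. M)) =
      (\<integral>\<^sup>+x. (\<Prod>i\<in>{1..n}. 1) * (\<Prod>(i, j)\<in>?D. ennreal (k (x i) (x j))) \<partial>PiM {1..n} (\<lambda>_. M))"
    using nonneg by (simp add: case_prod_beta' prod_ennreal)
  also have "\<dots> = part_int M (\<lambda>x y. ennreal (k x y)) n (\<lambda>_. 1)"
    by (rule PiM_nn_integral_eq_part_int[OF M]) measurable
  finally show ?thesis .
qed

text \<open>After division by \<open>fact n\<close> the binomial convolution of
  \<open>part_int_Un\<close> is a Cauchy product.\<close>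

lemma part_int_fps_Un:
  fixes M :: "'a measure" and k :: "'a \<Rightarrow> 'a \<Rightarrow> ennreal"
  defines "F \<equiv> \<lambda>S. Abs_fps (\<lambda>n. complex_of_real (enn2real (part_int M k n (indicator S))) / fact n)"
  assumes M: "sigma_finite_measure M" and le: "emeasure M (space M) \<le> 1"
    and k: "case_prod k \<in> borel_measurable (M \<Otimes>\<^sub>M M)"
    and k1: "\<And>x y. x \<in> space M \<Longrightarrow> y \<in> space M \<Longrightarrow> k x y \<le> 1"
    and ST: "S \<in> sets M" "T \<in> sets M" "S \<inter> T = {}"
    and one: "\<And>x y. x \<in> S \<Longrightarrow> y \<in> T \<Longrightarrow> k x y = 1 \<and> k y x = 1"
  shows "F (S \<union> T) = F S * F T"
proof (rule fps_ext)
  fix n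
  let ?z = "\<lambda>S n. enn2real (part_int M k n (indicator S))"
  \<comment> \<open>The bound gives the finiteness that \<open>enn2real\<close> needs in order to
    respect products and sums.\<close>
  have "part_int M k n (indicator A) \<le> 1" for n A
    by (rule part_int_le_1[OF le k1]) (auto simp: indicator_def)
  then have fin: "part_int M k n (indicator A) < top" for n A
    by (metis ennreal_one_less_top order_le_less_trans)
  have "part_int M k n (indicator (S \<union> T)) =
      (\<Sum>i\<le>n. of_nat (n choose i) * (part_int M k i (indicator S) * part_int M k (n - i) (indicator T)))"
    using part_int_Un[OF M k ST one, of "\<lambda>_. 1" n] by simp
  also have "\<dots> = (\<Sum>i\<le>n. ennreal (real (n choose i) * (?z S i * ?z T (n - i))))"
    using fin by (simp add: ennreal_mult ennreal_of_nat_eq_real_of_nat)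
  also have "\<dots> = ennreal (\<Sum>i\<le>n. real (n choose i) * (?z S i * ?z T (n - i)))"
    by (rule sum_ennreal) simp
  finally have z: "?z (S \<union> T) n = (\<Sum>i\<le>n. real (n choose i) * (?z S i * ?z T (n - i)))"
    by (simp add: sum_nonneg)
  have "fps_nth (F (S \<union> T)) n = (\<Sum>i\<le>n. complex_of_real (real (n choose i) * (?z S i * ?z T (n - i))) / fact n)"
    by (simp add: F_def z sum_divide_distrib del: of_real_mult)
  also have "\<dots> = (\<Sum>i\<le>n. (of_real (?z S i) / fact i) * (of_real (?z T (n - i)) / fact (n - i)))"
    by (intro sum.cong refl) (simp add: binomial_fact field_simps)
  also have "\<dots> = fps_nth (F S * F T) n"
    by (simp add: F_def fps_mult_nth atLeast0AtMost)
  finally show "fps_nth (F (S \<union> T)) n = fps_nth (F S * F T) n" .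
qed

section \<open>Nonarchimedean local fields\<close>

lemma absv_eq_dist: "absv (x::'k::nonarch_valued_field) = dist x 0"
  by (simp add: dist_absv)

lemma absv_nonneg [simp]: "absv (x::'k::nonarch_valued_field) \<ge> 0"
  by (simp add: absv_eq_dist)

lemma absv_not_less_0 [simp]: "\<not> absv (x::'k::nonarch_valued_field) < 0"
  by (simp add: not_less)

lemma absv_eq_0_iff [simp]: "absv (x::'k::nonarch_valued_field) = 0 \<longleftrightarrow> x = 0"
  by (simp add: absv_eq_dist)

lemma absv_le_0_iff [simp]: "absv (x::'k::nonarch_valued_field) \<le> 0 \<longleftrightarrow> x = 0"
  by (simp add: absv_eq_dist)

lemma absv_0 [simp]: "absv (0::'k::nonarch_valued_field) = 0"
  by simp

lemma absv_1 [simp]: "absv (1::'k::nonarch_valued_field) = 1"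
  using absv_mult[of "1::'k" 1] absv_pos[of "1::'k"] by simp

lemma absv_diff_commute: "absv (x - y) = absv (y - x :: 'k::nonarch_valued_field)"
  by (metis dist_absv dist_commute)

lemma absv_minus [simp]: "absv (- x) = absv (x::'k::nonarch_valued_field)"
  using absv_diff_commute[of 0 x] by simp

lemma absv_diff_ultrametric: "absv (x - y :: 'k::nonarch_valued_field) \<le> max (absv x) (absv y)"
  using absv_ultrametric[of x "- y"] by simp

lemma absv_add_eq:
  assumes "absv (y::'k::nonarch_valued_field) < absv x"
  shows "absv (x + y) = absv x"
  using absv_ultrametric[of x y] absv_diff_ultrametric[of "x + y" y] assms by auto

lemma absv_power: "absv (x ^ n) = absv (x::'k::nonarch_valued_field) ^ n"
  by (induction n) (simp_all add: absv_mult)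

text \<open>Together with second countability this makes addition Borel measurable, as needed for
  translates of sets and for the Fubini argument.\<close>

instance nonarch_valued_field \<subseteq> topological_ab_group_add
proof
  show "((\<lambda>x. fst x + snd x) \<longlongrightarrow> a + b) (nhds a \<times>\<^sub>F nhds b)" for a b :: 'a
  proof (rule tendstoI)
    fix e :: real assume "e > 0"
    have "\<forall>\<^sub>F x in nhds a. x \<in> ball a e" "\<forall>\<^sub>F x in nhds b. x \<in> ball b e"
      using \<open>e > 0\<close> by (intro eventually_nhds_in_open; simp)+
    then have "\<forall>\<^sub>F x in nhds a \<times>\<^sub>F nhds b. fst x \<in> ball a e \<and> snd x \<in> ball b e"
      by (rule eventually_prodI)
    then show "\<forall>\<^sub>F x in nhds a \<times>\<^sub>F nhds b. dist (fst x + snd x) (a + b) < e"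
    proof eventually_elim
      case (elim x)
      have "absv (fst x + snd x - (a + b)) = absv ((fst x - a) + (snd x - b))"
        by (simp add: algebra_simps)
      also have "\<dots> < e"
        by (rule le_less_trans[OF absv_ultrametric]) (use elim in \<open>simp add: dist_absv absv_diff_commute\<close>)
      finally show ?case by (simp add: dist_absv)
    qed
  qed
  show "(uminus \<longlongrightarrow> - a) (nhds a)" for a :: 'a
  proof (rule tendstoI)
    fix e :: real assume "e > 0"
    then have "\<forall>\<^sub>F x in nhds a. x \<in> ball a e"
      by (intro eventually_nhds_in_open) auto
    then show "\<forall>\<^sub>F x in nhds a. dist (- x) (- a) < e"
    proof eventually_elim
      case (elim x)
      have "absv (- x - - a) = absv (a - x)" by simp
      with elim show ?case by (simp add: dist_absv)
    qed
  qed
qed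

lemma continuous_on_absv [continuous_intros]:
  "continuous_on A f \<Longrightarrow> continuous_on A (\<lambda>x. absv (f x :: 'k::nonarch_valued_field))"
  unfolding absv_eq_dist by (intro continuous_intros)

lemma continuous_on_mult_const [continuous_intros]:
  fixes f :: "'a::topological_space \<Rightarrow> 'k::nonarch_valued_field"
  assumes "continuous_on A f"
  shows "continuous_on A (\<lambda>x. c * f x)"
proof -
  have "continuous_on UNIV ((*) c)"
  proof (cases "c = 0")
    case False
    show ?thesis
    proof (rule continuous_onI, goal_cases)
      case (1 x e)
      have "dist (c * x') (c * x) \<le> e" if "dist x' x < e / absv c" for x'
      proof -
        have "dist (c * x') (c * x) = absv c * dist x' x"
          by (simp add: dist_absv flip: right_diff_distrib absv_mult)
        then show ?thesis using that absv_pos[OF False] by (simp add: field_simps)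
      qed
      then show ?case using 1 absv_pos[OF False] by (intro exI[of _ "e / absv c"]) auto
    qed
  qed (simp add: lambda_zero continuous_on_const)
  from continuous_on_compose2[OF this assms] show ?thesis by simp
qed

section \<open>Consequences of local compactness\<close>

lemma absv_lt_1_exists: "\<exists>t::'k::nonarch_local_field. 0 < absv t \<and> absv t < 1"
proof -
  obtain x :: 'k where x: "x \<noteq> 0" "absv x \<noteq> 1" using absv_nontrivial by blast
  show ?thesis
  proof (cases "absv x < 1")
    case True
    then show ?thesis using absv_pos[OF x(1)] by blast
  next
    case False
    have "absv x * absv (inverse x) = 1" using x by (simp flip: absv_mult)
    then have "absv (inverse x) = 1 / absv x" using x(1) by (simp add: field_simps)
    then show ?thesis using False x by (intro exI[of _ "inverse x"]) auto
  qed
qed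

text \<open>Local compactness gives one compact neighbourhood of 0. A scalar \<open>s\<close> of
  small absolute value shrinks the ball into it, and scaling back by \<open>inverse s\<close>
  preserves compactness.\<close>

lemma compact_absv_le: "compact {x::'k::nonarch_local_field. absv x \<le> r}"
proof -
  obtain U C :: "'k set" where UC: "open U" "0 \<in> U" "U \<subseteq> C" "compact C"
    using loc_compact[of 0] by blast
  obtain e where e: "e > 0" "ball 0 e \<subseteq> U" using UC openE by blast
  obtain t :: 'k where t: "0 < absv t" "absv t < 1" using absv_lt_1_exists by blast
  \<comment> \<open>The denominator exceeds \<open>r\<close> and is positive for every real
    \<open>r\<close>, including negative ones.\<close>
  obtain n where n: "absv t ^ n < e / (\<bar>r\<bar> + 1)"
    using real_arch_pow_inv[of "e / (\<bar>r\<bar> + 1)" "absv t"] e t by auto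
  define s where "s = t ^ n"
  have s: "s \<noteq> 0" "0 < absv s" using t by (auto simp: s_def absv_power)
  have "r * absv s < e"
  proof -
    have "r * absv s \<le> (\<bar>r\<bar> + 1) * absv s" using s by (intro mult_right_mono) auto
    also have "\<dots> < e" using n by (simp add: s_def absv_power field_simps)
    finally show ?thesis .
  qed
  then have "{x. absv x \<le> r * absv s} \<subseteq> C"
    using e(2) UC(3) by (auto simp: dist_absv subset_iff)
  moreover have "closed {x::'k. absv x \<le> r * absv s}"
    by (intro closed_Collect_le continuous_intros)
  ultimately have "compact {x::'k. absv x \<le> r * absv s}"
    using UC(4) by (metis compact_Int_closed inf.absorb2)
  then have "compact ((\<lambda>x. inverse s * x) ` {x. absv x \<le> r * absv s})"
    by (intro compact_continuous_image continuous_intros)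
  also have "(\<lambda>x. inverse s * x) ` {x. absv x \<le> r * absv s} = {x. absv x \<le> r}"
  proof (intro subset_antisym subsetI, goal_cases)
    case (1 y)
    then obtain x where "y = inverse s * x" "absv x \<le> r * absv s" by auto
    then have "x = y * s" using s by simp
    then show ?case using \<open>absv x \<le> r * absv s\<close> s by (simp add: absv_mult)
  next
    case (2 y)
    then show ?case using s by (intro image_eqI[of _ _ "s * y"]) (auto simp: absv_mult mult.commute)
  qed
  finally show ?thesis .
qed

text \<open>The field is a countable union of compact balls, and finite nets of mesh 1/(m + 1) in
  them give the centres of a countable basis. Then sums and distances are measurable for products of
  Borel sigma-algebras.\<close>

instance nonarch_local_field \<subseteq> second_countable_topology
proof
  have "\<exists>K. finite K \<and> {x::'a. absv x \<le> real n} \<subseteq> (\<Union>x\<in>K. ball x (1 / real (Suc m)))" for n m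
    using compact_absv_le[of "real n", where ?'k = 'a] unfolding compact_eq_totally_bounded by simp
  then obtain K :: "nat \<Rightarrow> nat \<Rightarrow> 'a set" where K: "\<And>n m. finite (K n m)"
    "\<And>n m. {x. absv x \<le> real n} \<subseteq> (\<Union>x\<in>K n m. ball x (1 / real (Suc m)))"
    by metis
  define B where "B = (\<Union>n m. (\<lambda>x. ball x (1 / real (Suc m))) ` K n m)"
  have "topological_basis B"
  proof (rule topological_basisI)
    fix O' and x :: 'a assume "open O'" "x \<in> O'"
    then obtain e where e: "e > 0" "ball x e \<subseteq> O'" using openE by blast
    obtain m where m: "1 / real (Suc m) < e / 2" using nat_approx_posE[of "e / 2"] e by auto
    obtain n where "absv x \<le> real n" using real_arch_simple by blast
    then obtain y where y: "y \<in> K n m" "x \<in> ball y (1 / real (Suc m))" using K(2)[of n m] by blast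
    have "ball y (1 / real (Suc m)) \<subseteq> ball x e"
    proof
      fix z assume "z \<in> ball y (1 / real (Suc m))"
      then have "dist x z < 1 / real (Suc m) + 1 / real (Suc m)"
        using y(2) dist_triangle[of x z y] by (simp add: dist_commute)
      then show "z \<in> ball x e" using m by simp
    qed
    then show "\<exists>B'\<in>B. x \<in> B' \<and> B' \<subseteq> O'" using y e unfolding B_def by blast
  qed (auto simp: B_def)
  moreover have "countable B" unfolding B_def using K(1) by (intro countable_UN countable_image) (auto simp: countable_finite)
  ultimately show "\<exists>B::'a set set. countable B \<and> open = generate_topology B"
    using topological_basis_imp_subbasis by blast
qed

section \<open>Residue classes of the ring of integers\<close>

lemma closed_int_ring: "closed (int_ring :: 'k::nonarch_valued_field set)"
  unfolding int_ring_def by (intro closed_Collect_le continuous_intros)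

lemma open_max_ideal: "open (max_ideal :: 'k::nonarch_valued_field set)"
  unfolding max_ideal_def by (intro open_Collect_less continuous_intros)

lemma max_ideal_borel [measurable]: "max_ideal \<in> sets (borel :: 'k::nonarch_valued_field measure)"
  by (rule borel_open[OF open_max_ideal])

lemma max_ideal_add: "x \<in> max_ideal \<Longrightarrow> y \<in> max_ideal \<Longrightarrow> x + y \<in> (max_ideal :: 'k::nonarch_valued_field set)"
  using absv_ultrametric[of x y] by (auto simp: max_ideal_def)

lemma max_ideal_diff: "x \<in> max_ideal \<Longrightarrow> y \<in> max_ideal \<Longrightarrow> x - y \<in> (max_ideal :: 'k::nonarch_valued_field set)"
  using absv_diff_ultrametric[of x y] by (auto simp: max_ideal_def)

lemma max_ideal_add_cancel:
  "y \<in> max_ideal \<Longrightarrow> x + y \<in> max_ideal \<longleftrightarrow> x \<in> (max_ideal :: 'k::nonarch_valued_field set)"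
  using max_ideal_add[of x y] max_ideal_diff[of "x + y" y] by auto

text \<open>Points of R at distance less than 1 have the same residue, so a finite cover of the
  compact ring R by unit balls meets every class. This finiteness gives \<open>residue_card\<close>
  its meaning, since \<open>card\<close> of an infinite set is 0. Two distinct representatives
  differ by an element of R outside P, hence have distance exactly 1.\<close>

lemma residue_representatives:
  obtains T :: "'k::nonarch_local_field set"
  where "finite T" "card T = residue_card TYPE('k)"
    and "\<And>t. t \<in> T \<Longrightarrow> absv t \<le> 1"
    and "\<And>x. absv x \<le> 1 \<Longrightarrow> \<exists>t\<in>T. x - t \<in> max_ideal"
    and "\<And>s t. s \<in> T \<Longrightarrow> t \<in> T \<Longrightarrow> s \<noteq> t \<Longrightarrow> absv (s - t) = 1"
proof -
  let ?r = "{(x, y). x \<in> int_ring \<and> y \<in> int_ring \<and> x - y \<in> (max_ideal :: 'k set)}"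
  let ?Q = "int_ring // ?r"
  have eq: "equiv int_ring ?r"
  proof (rule equivI)
    show "sym ?r" by (auto simp: sym_def max_ideal_def absv_diff_commute)
    show "trans ?r"
    proof (rule transI, goal_cases)
      case (1 x y z)
      then show ?case using max_ideal_add[of "x - y" "y - z"] by auto
    qed
  qed (auto simp: refl_on_def max_ideal_def)
  have "compact (int_ring :: 'k set)" using compact_absv_le[of 1] by (simp add: int_ring_def)
  then obtain D where D: "D \<subseteq> (int_ring :: 'k set)" "finite D" "int_ring \<subseteq> (\<Union>c\<in>D. ball c 1)"
    by (rule compactE_image[of int_ring int_ring "\<lambda>c. ball c 1"]) auto
  have "?Q \<subseteq> (\<lambda>c. ?r `` {c}) ` D"
  proof
    fix X assume "X \<in> ?Q"
    then obtain x where x: "x \<in> int_ring" "X = ?r `` {x}" by (auto elim: quotientE)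
    then obtain c where c: "c \<in> D" "dist c x < 1" using D(3) by auto
    then have "(c, x) \<in> ?r" using D(1) x by (auto simp: max_ideal_def dist_absv)
    then show "X \<in> (\<lambda>c. ?r `` {c}) ` D" using equiv_class_eq[OF eq] x c by auto
  qed
  then have fin: "finite ?Q" using D(2) finite_surj by blast
  define g where "g X = (SOME x. x \<in> X)" for X :: "'k set"
  have g: "g X \<in> X" if "X \<in> ?Q" for X
    unfolding g_def using in_quotient_imp_non_empty[OF eq that] by (simp add: some_in_eq)
  have gR: "g X \<in> int_ring" if "X \<in> ?Q" for X
    using g[OF that] in_quotient_imp_subset[OF eq that] by blast
  have inj: "X = Y" if "X \<in> ?Q" "Y \<in> ?Q" "g X - g Y \<in> max_ideal" for X Y
    using quotient_eqI[OF eq that(1,2) g[OF that(1)] g[OF that(2)]] that gR by simp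
  show ?thesis
  proof (rule that[of "g ` ?Q"])
    have "inj_on g ?Q" by (rule inj_onI, rule inj) (auto simp: max_ideal_def)
    then show "card (g ` ?Q) = residue_card TYPE('k)"
      unfolding residue_card_def by (rule card_image)
    show "absv t \<le> 1" if "t \<in> g ` ?Q" for t using that gR by (auto simp: int_ring_def)
    show "\<exists>t\<in>g ` ?Q. x - t \<in> max_ideal" if "absv x \<le> 1" for x
    proof -
      have "x \<in> int_ring" using that by (simp add: int_ring_def)
      then have "?r `` {x} \<in> ?Q" by (rule quotientI)
      from g[OF this] show ?thesis using \<open>?r `` {x} \<in> ?Q\<close> by auto
    qed
    show "absv (s - t) = 1" if st: "s \<in> g ` ?Q" "t \<in> g ` ?Q" "s \<noteq> t" for s t
    proof -
      obtain X Y where XY: "X \<in> ?Q" "Y \<in> ?Q" "s = g X" "t = g Y" using st by auto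
      then have "s - t \<notin> max_ideal" using inj st(3) by blast
      moreover have "absv (s - t) \<le> 1"
        using absv_diff_ultrametric[of s t] gR[OF XY(1)] gR[OF XY(2)] XY by (simp add: int_ring_def)
      ultimately show ?thesis by (simp add: max_ideal_def)
    qed
  qed (use fin in simp)
qed

section \<open>Haar measure on the maximal ideal\<close>

lemma normalized_haar_translate:
  assumes "normalized_haar \<mu>" "S \<in> sets borel"
  shows "emeasure \<mu> {x. x + a \<in> S} = emeasure \<mu> S"
proof -
  have "{x. x + a \<in> S} = (\<lambda>x. - a + x) ` S"
    by (auto intro!: image_eqI[of _ _ "_ + a"])
  with assms show ?thesis unfolding normalized_haar_def by metis
qed

lemma emeasure_max_ideal_le_1:
  assumes "normalized_haar \<mu>"
  shows "emeasure \<mu> max_ideal \<le> 1"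
proof -
  have "emeasure \<mu> max_ideal \<le> emeasure \<mu> int_ring"
    using assms borel_closed[OF closed_int_ring]
    by (intro emeasure_mono) (auto simp: normalized_haar_def max_ideal_def int_ring_def)
  then show ?thesis using assms by (simp add: normalized_haar_def)
qed

text \<open>R is the disjoint union of its residue classes, which are q translates of P. The
  multiplied form avoids division in \<open>ennreal\<close>.\<close>

lemma emeasure_max_ideal:
  fixes \<mu> :: "'k::nonarch_local_field measure"
  assumes "normalized_haar \<mu>"
  shows "of_nat (residue_card TYPE('k)) * emeasure \<mu> max_ideal = 1"
proof -
  obtain T :: "'k set" where T: "finite T" "card T = residue_card TYPE('k)"
    "\<And>t. t \<in> T \<Longrightarrow> absv t \<le> 1" "\<And>x. absv x \<le> 1 \<Longrightarrow> \<exists>t\<in>T. x - t \<in> max_ideal"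
    "\<And>s t. s \<in> T \<Longrightarrow> t \<in> T \<Longrightarrow> s \<noteq> t \<Longrightarrow> absv (s - t) = 1"
    by (rule residue_representatives[where ?'k = 'k]) blast
  have sets: "sets \<mu> = sets borel" using assms by (simp add: normalized_haar_def)
  have meas: "{x. x + - t \<in> max_ideal} \<in> sets \<mu>" for t :: 'k
    unfolding sets by measurable
  have "int_ring = (\<Union>t\<in>T. {x. x + - t \<in> max_ideal})"
  proof (intro subset_antisym subsetI, goal_cases)
    case (1 x)
    then show ?case using T(4)[of x] by (simp add: int_ring_def)
  next
    case (2 x)
    then obtain t where "t \<in> T" "absv (x - t) < 1" by (auto simp: max_ideal_def)
    then show ?case using absv_ultrametric[of "x - t" t] T(3)[of t] by (simp add: int_ring_def)
  qed
  moreover have "disjoint_family_on (\<lambda>t. {x. x + - t \<in> max_ideal}) T"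
  proof (unfold disjoint_family_on_def, intro ballI impI, goal_cases)
    case (1 s t)
    have False if "x + - s \<in> max_ideal" "x + - t \<in> max_ideal" for x
      using max_ideal_diff[OF that(2,1)] T(5)[OF 1] by (simp add: max_ideal_def)
    then show ?case by auto
  qed
  ultimately have "emeasure \<mu> int_ring = (\<Sum>t\<in>T. emeasure \<mu> {x. x + - t \<in> max_ideal})"
    using meas by (subst sum_emeasure) (auto simp: T(1))
  also have "\<dots> = of_nat (card T) * emeasure \<mu> max_ideal"
    by (simp only: normalized_haar_translate[OF assms max_ideal_borel] sum_constant)
  finally show ?thesis using assms by (simp add: T(2) normalized_haar_def)
qed

text \<open>Compute the measure of \<open>{(x, y). x + y \<in> S}\<close> by Fubini in both orders.\<close>

lemma max_ideal_invariant_unique: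
  fixes m1 m2 :: "'k::nonarch_local_field measure"
  assumes fin: "finite_measure m1" "finite_measure m2"
    and sets: "sets m1 = sets borel" "sets m2 = sets borel"
    and AE: "AE x in m1. x \<in> max_ideal" "AE x in m2. x \<in> max_ideal"
    and inv1: "\<And>y S. y \<in> max_ideal \<Longrightarrow> S \<in> sets borel \<Longrightarrow> emeasure m1 {x. x + y \<in> S} = emeasure m1 S"
    and inv2: "\<And>y S. y \<in> max_ideal \<Longrightarrow> S \<in> sets borel \<Longrightarrow> emeasure m2 {x. x + y \<in> S} = emeasure m2 S"
    and S: "S \<in> sets borel"
  shows "emeasure m1 S * emeasure m2 UNIV = emeasure m2 S * emeasure m1 UNIV"
proof -
  interpret m1: finite_measure m1 by fact
  interpret m2: finite_measure m2 by fact
  interpret pair_sigma_finite m1 m2 by unfold_locales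
  note [measurable_cong] = sets and [measurable] = S
  have sp: "space m1 = UNIV" "space m2 = UNIV" using sets[THEN sets_eq_imp_space_eq] by auto
  have i1: "(\<integral>\<^sup>+x. indicator S (x + y) \<partial>m1) = emeasure m1 {x. x + y \<in> S}" for y
  proof -
    have "{x. x + y \<in> S} \<in> sets m1" unfolding sets by measurable
    from nn_integral_indicator[OF this] show ?thesis by (simp add: indicator_def)
  qed
  have i2: "(\<integral>\<^sup>+y. indicator S (x + y) \<partial>m2) = emeasure m2 {y. y + x \<in> S}" for x
  proof -
    have "{y. y + x \<in> S} \<in> sets m2" unfolding sets by measurable
    from nn_integral_indicator[OF this] show ?thesis by (simp add: indicator_def add.commute)
  qed
  have "(\<integral>\<^sup>+y. (\<integral>\<^sup>+x. indicator S (x + y) \<partial>m1) \<partial>m2) = (\<integral>\<^sup>+x. (\<integral>\<^sup>+y. indicator S (x + y) \<partial>m2) \<partial>m1)"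
    by (rule Fubini') measurable
  \<comment> \<open>Invariance is available only for translations by P, but almost every
    \<open>y\<close> lies there, so the inner integral is almost everywhere constant.\<close>
  moreover have "(\<integral>\<^sup>+y. (\<integral>\<^sup>+x. indicator S (x + y) \<partial>m1) \<partial>m2) = (\<integral>\<^sup>+y. emeasure m1 S \<partial>m2)"
    unfolding i1 using AE(2) by (intro nn_integral_cong_AE) (auto simp: inv1 S)
  moreover have "(\<integral>\<^sup>+x. (\<integral>\<^sup>+y. indicator S (x + y) \<partial>m2) \<partial>m1) = (\<integral>\<^sup>+x. emeasure m2 S \<partial>m1)"
    unfolding i2 using AE(1) by (intro nn_integral_cong_AE) (auto simp: inv2 S)
  ultimately show ?thesis by (simp add: sp)
qed

section \<open>The projective line\<close>

lemma proj_eq_iff: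
  assumes "x \<noteq> 0" "y \<noteq> 0"
  shows "proj x = proj y \<longleftrightarrow> (\<exists>c. c \<noteq> 0 \<and> y = c *s x)"
proof -
  have "proj x = proj y \<longleftrightarrow> proj_rel x y"
    using Quotient3_rel[OF Quotient3_proj_line, of x y] assms proj_rel_refl by blast
  then show ?thesis using assms by (simp add: proj_rel_def)
qed

lemma proj_rep_proj: "rep_proj p \<noteq> 0" "proj (rep_proj p) = p"
  using Quotient3_rep_reflp[OF Quotient3_proj_line, of p] Quotient3_abs_rep[OF Quotient3_proj_line, of p]
  by (auto simp: proj_rel_def)

lemma proj_cases:
  obtains x where "x \<noteq> 0" "p = proj x"
  using that[of "rep_proj p"] by (simp add: proj_rep_proj)

lemma rep_proj_proj:
  assumes "x \<noteq> 0"
  obtains c where "c \<noteq> 0" "rep_proj (proj x) = c *s x"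
  using proj_eq_iff[OF assms proj_rep_proj(1), of "proj x"] by (auto simp: proj_rep_proj)

lemma sph_dist_proj:
  assumes "x \<noteq> 0" "y \<noteq> 0"
  shows "sph_dist (proj x) (proj y) = absv (x $ 1 * y $ 2 - x $ 2 * y $ 1) /
    (max (absv (x $ 1)) (absv (x $ 2)) * max (absv (y $ 1)) (absv (y $ 2)))"
  using assms by (intro sph_dist.abs_eq proj_rel_refl)

text \<open>The nonzero vectors form an open set, so openness on the projective line can be tested
  in the full plane.\<close>

lemma open_proj_line_iff:
  "open U \<longleftrightarrow> open {x::'k::nonarch_valued_field ^ 2. x \<noteq> 0 \<and> proj x \<in> U}"
proof -
  have "open {x::'k ^ 2. x \<noteq> 0}" by (simp add: Collect_neg_eq open_Compl)
  from openin_open_eq[OF this] show ?thesis unfolding open_proj_line_def by auto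
qed

section \<open>The action of integral matrices\<close>

lemma matrix_vector_mult_2:
  "(A *v x) $ 1 = A $ 1 $ 1 * x $ 1 + A $ 1 $ 2 * x $ 2"
  "(A *v x) $ 2 = A $ 2 $ 1 * x $ 1 + A $ 2 $ 2 * x $ 2"
  for A :: "'a::semiring_1 ^ 2 ^ 2"
  by (simp_all add: matrix_vector_mult_def sum_2)

lemma vec_eq_0_iff_2: "x = 0 \<longleftrightarrow> x $ 1 = 0 \<and> x $ 2 = 0" for x :: "'a::zero ^ 2"
  by (simp add: vec_eq_iff forall_2)

lemma GL2_int_inverse:
  assumes "A \<in> GL2_int"
  obtains B where "B \<in> GL2_int" "A ** B = mat 1" "B ** A = mat 1"
  using assms unfolding GL2_int_def by blast

lemma GL2_int_mult_nonzero:
  assumes "A \<in> GL2_int" "x \<noteq> 0"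
  shows "A *v x \<noteq> 0"
proof
  assume "A *v x = 0"
  obtain B where "B ** A = mat 1" using assms(1) by (rule GL2_int_inverse)
  then have "x = B *v (A *v x)" by (simp add: matrix_vector_mul_assoc)
  with \<open>A *v x = 0\<close> assms(2) show False by simp
qed

lemma proj_act_cancel:
  assumes "A \<in> GL2_int" "B \<in> GL2_int" "A ** B = mat 1"
  shows "proj_act A (proj_act B p) = p"
proof -
  obtain x where "x \<noteq> 0" "p = proj x" by (rule proj_cases)
  then show ?thesis
    using assms by (simp add: proj_act_proj GL2_int_mult_nonzero matrix_vector_mul_assoc)
qed

lemma measurable_proj_act:
  fixes A :: "'k::nonarch_valued_field ^ 2 ^ 2"
  assumes A: "A \<in> GL2_int"
  shows "proj_act A \<in> borel_measurable borel"
proof (rule borel_measurableI)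
  fix U :: "'k proj_line set" assume "open U"
  have "continuous_on UNIV (\<lambda>x. A *v x)"
    unfolding matrix_vector_mult_def sum_2 by (intro continuous_intros)
  then have "open ((\<lambda>x. A *v x) -` {x. x \<noteq> 0 \<and> proj x \<in> U})"
    using \<open>open U\<close> by (intro open_vimage) (simp_all flip: open_proj_line_iff)
  also have "(\<lambda>x. A *v x) -` {x. x \<noteq> 0 \<and> proj x \<in> U} = {x. x \<noteq> 0 \<and> proj x \<in> proj_act A -` U}"
  proof (rule set_eqI)
    fix x
    show "x \<in> (\<lambda>x. A *v x) -` {x. x \<noteq> 0 \<and> proj x \<in> U} \<longleftrightarrow> x \<in> {x. x \<noteq> 0 \<and> proj x \<in> proj_act A -` U}"
      using GL2_int_mult_nonzero[OF A, of x] proj_act_proj[OF A, of x] by (cases "x = 0") simp_all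
  qed
  finally have "open (proj_act A -` U)" by (simp only: open_proj_line_iff)
  then show "proj_act A -` U \<inter> space borel \<in> sets borel" by simp
qed

text \<open>\<open>invariant_prob\<close> speaks of images, integration of preimages. The preimage
  under \<open>A\<close> is the image under the inverse matrix, which is again in
  \<open>GL2_int\<close>.\<close>

lemma emeasure_vimage_proj_act:
  assumes "invariant_prob \<nu>" "A \<in> GL2_int" "S \<in> sets borel"
  shows "emeasure \<nu> {p. proj_act A p \<in> S} = emeasure \<nu> S"
proof -
  obtain B where B: "B \<in> GL2_int" "A ** B = mat 1" "B ** A = mat 1"
    using assms(2) by (rule GL2_int_inverse)
  have "{p. proj_act A p \<in> S} = proj_act B ` S"
    using assms(2) B by (auto simp: proj_act_cancel intro!: image_eqI[of _ _ "proj_act A _"])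
  with assms B show ?thesis by (simp add: invariant_prob_def)
qed

lemma nn_integral_proj_act:
  assumes \<nu>: "invariant_prob \<nu>" and A: "A \<in> GL2_int" and f: "f \<in> borel_measurable borel"
  shows "(\<integral>\<^sup>+p. f (proj_act A p) \<partial>\<nu>) = (\<integral>\<^sup>+p. f p \<partial>\<nu>)"
proof -
  have sets: "sets \<nu> = sets borel" using \<nu> by (simp add: invariant_prob_def)
  have m: "proj_act A \<in> measurable \<nu> \<nu>"
    using measurable_proj_act[OF A] by (simp cong: measurable_cong_sets add: sets)
  have "distr \<nu> \<nu> (proj_act A) = \<nu>"
    using emeasure_vimage_proj_act[OF \<nu> A]
    by (intro measure_eqI) (auto simp: emeasure_distr m sets sets_eq_imp_space_eq[OF sets] vimage_def)
  with nn_integral_distr[OF m, of f] show ?thesis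
    using f by (simp cong: measurable_cong_sets add: sets)
qed

text \<open>\<open>base_ball\<close> is the open unit ball around \<open>[1 : 0]\<close>, and \<open>slope\<close> its coordinate \<open>x\<^sub>1 / x\<^sub>0\<close>.\<close>

definition base_ball :: "'k::nonarch_valued_field proj_line set" where
  "base_ball = {p. absv (rep_proj p $ 2) < absv (rep_proj p $ 1)}"

definition slope :: "'k::nonarch_valued_field proj_line \<Rightarrow> 'k" where
  "slope p = (if p \<in> base_ball then rep_proj p $ 2 / rep_proj p $ 1 else 0)"

lemma proj_in_base_ball:
  assumes "x \<noteq> 0"
  shows "proj x \<in> base_ball \<longleftrightarrow> absv (x $ 2) < absv (x $ 1)"
proof -
  obtain c where "c \<noteq> 0" "rep_proj (proj x) = c *s x" using rep_proj_proj[OF assms] .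
  then show ?thesis using absv_pos[of c] by (simp add: base_ball_def absv_mult)
qed

lemma slope_proj:
  assumes "x \<noteq> 0" "proj x \<in> base_ball"
  shows "slope (proj x) = x $ 2 / x $ 1"
proof -
  obtain c where "c \<noteq> 0" "rep_proj (proj x) = c *s x" using rep_proj_proj[OF assms(1)] .
  then show ?thesis using assms(2) by (simp add: slope_def)
qed

lemma base_ball_borel [measurable]:
  "base_ball \<in> sets (borel :: 'k::nonarch_valued_field proj_line measure)"
proof -
  have "open {x :: 'k ^ 2. absv (x $ 2) < absv (x $ 1)}"
    by (intro open_Collect_less continuous_intros)
  also have "{x :: 'k ^ 2. absv (x $ 2) < absv (x $ 1)} = {x. x \<noteq> 0 \<and> proj x \<in> base_ball}"
  proof -
    have "x \<noteq> 0" if "absv (x $ 2) < absv (x $ 1)" for x :: "'k ^ 2" using that by auto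
    then show ?thesis by (auto simp: proj_in_base_ball)
  qed
  finally have "open (base_ball :: 'k proj_line set)" by (simp only: open_proj_line_iff)
  then show ?thesis by (rule borel_open)
qed

text \<open>Clearing the denominator in the condition that the slope is within \<open>e\<close> of
  \<open>u\<close> leaves an inequality between absolute values of linear forms, which is open in
  the plane. These conditions, over all balls contained in \<open>U\<close>, cover the part of the
  preimage inside \<open>base_ball\<close>.\<close>

lemma borel_measurable_slope [measurable]:
  "slope \<in> borel_measurable (borel :: 'k::nonarch_valued_field proj_line measure)"
proof (rule borel_measurableI)
  fix U :: "'k set" assume "open U"
  let ?V = "{p \<in> base_ball. slope p \<in> U}"
  let ?W = "\<lambda>u e. {x :: 'k ^ 2. absv (x $ 2) < absv (x $ 1) \<and> absv (x $ 2 - u * x $ 1) < e * absv (x $ 1)}"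
  have W: "x \<in> ?W u e \<longleftrightarrow> x \<noteq> 0 \<and> proj x \<in> base_ball \<and> dist u (slope (proj x)) < e" for x u e
  proof (cases "x $ 1 = 0")
    case False
    then have "x \<noteq> 0" by auto
    have "x $ 2 - u * x $ 1 = (slope (proj x) - u) * x $ 1" if "proj x \<in> base_ball"
      using that \<open>x \<noteq> 0\<close> False by (simp add: slope_proj field_simps)
    then show ?thesis
      using \<open>x \<noteq> 0\<close> absv_pos[OF False]
      by (auto simp: proj_in_base_ball dist_absv absv_mult absv_diff_commute[of u])
  next
    case True
    then show ?thesis by (cases "x = 0") (simp_all add: proj_in_base_ball)
  qed
  have "open (\<Union>(u, e)\<in>{(u, e). ball u e \<subseteq> U}. ?W u e)"
    by (intro open_UN ballI, clarify, intro open_Collect_conj open_Collect_less continuous_intros)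
  also have "(\<Union>(u, e)\<in>{(u, e). ball u e \<subseteq> U}. ?W u e) = {x. x \<noteq> 0 \<and> proj x \<in> ?V}"
  proof (intro subset_antisym subsetI, goal_cases)
    case (1 x)
    then obtain u e where "ball u e \<subseteq> U" "x \<in> ?W u e" by auto
    then show ?case unfolding W by auto
  next
    case (2 x)
    then obtain e where "e > 0" "ball (slope (proj x)) e \<subseteq> U" using \<open>open U\<close> openE by blast
    then have "x \<in> ?W (slope (proj x)) e" using 2 unfolding W by simp
    then show ?case using \<open>ball (slope (proj x)) e \<subseteq> U\<close> by blast
  qed
  finally have "open ?V" by (simp only: open_proj_line_iff)
  then have "?V \<in> sets borel" by (rule borel_open)
  \<comment> \<open>Outside \<open>base_ball\<close> the slope has the default value 0, so the rest
    of the preimage is the whole complement or empty.\<close>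
  moreover have "slope -` U = ?V \<union> (if 0 \<in> U then - base_ball else {})"
    by (auto simp: slope_def split: if_splits)
  ultimately show "slope -` U \<inter> space borel \<in> sets borel" by simp
qed

text \<open>The residue classes on the projective line: \<open>Some t\<close> is the ball around \<open>[1 : t]\<close>, and
  \<open>None\<close> the ball around \<open>[0 : 1]\<close>.\<close>

fun chart :: "'k::nonarch_valued_field option \<Rightarrow> 'k \<Rightarrow> 'k proj_line" where
  "chart (Some t) x = proj (vector [1, t + x])"
| "chart None x = proj (vector [x, 1])"

text \<open>These matrices move the ball around [1 : 0] to the ball with the given index: a shear
  for \<open>Some t\<close>, the coordinate swap for \<open>None\<close>. Negating the index inverts
  the matrix in both cases, as the swap is an involution; hence \<open>map_option uminus\<close>
  below.\<close>

fun chart_matrix :: "'k::nonarch_valued_field option \<Rightarrow> 'k ^ 2 ^ 2" where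
  "chart_matrix (Some t) = vector [vector [1, 0], vector [t, 1]]"
| "chart_matrix None = vector [vector [0, 1], vector [1, 0]]"

text \<open>The condition for \<open>chart_matrix c\<close> to have entries in R.\<close>

definition chart_index :: "'k::nonarch_valued_field option \<Rightarrow> bool" where
  "chart_index c \<longleftrightarrow> (\<forall>t. c = Some t \<longrightarrow> absv t \<le> 1)"

text \<open>Written as a preimage under the inverse matrix, so that measurability and measure are
  inherited from \<open>base_ball\<close>.\<close>

definition chart_ball :: "'k::nonarch_valued_field option \<Rightarrow> 'k proj_line set" where
  "chart_ball c = {p. proj_act (chart_matrix (map_option uminus c)) p \<in> base_ball}"

definition chart_coord :: "'k::nonarch_valued_field option \<Rightarrow> 'k proj_line \<Rightarrow> 'k" where
  "chart_coord c p = slope (proj_act (chart_matrix (map_option uminus c)) p)"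

lemma chart_vector_nonzero: "vector [1, u] \<noteq> (0 :: 'k::field ^ 2)" "vector [u, 1] \<noteq> (0 :: 'k ^ 2)"
  by (simp_all add: vec_eq_0_iff_2)

lemma chart_matrix_inverse:
  "chart_matrix c ** chart_matrix (map_option uminus c) = mat 1"
  "chart_matrix (map_option uminus c) ** chart_matrix c = mat 1"
  by (cases c; simp add: vec_eq_iff forall_2 matrix_matrix_mult_def sum_2 mat_def)+

lemma chart_index_uminus: "chart_index (map_option uminus c) \<longleftrightarrow> chart_index c"
  by (cases c) (simp_all add: chart_index_def)

lemma chart_matrix_GL2:
  assumes "chart_index c"
  shows "chart_matrix c \<in> GL2_int"
proof -
  have "chart_matrix d $ i $ j \<in> int_ring" if "chart_index d" for d :: "'a option" and i j
    using that exhaust_2[of i] exhaust_2[of j] by (cases d) (auto simp: int_ring_def chart_index_def)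
  then show ?thesis
    using assms chart_matrix_inverse[of c] chart_index_uminus[of c] unfolding GL2_int_def by blast
qed

text \<open>\<open>chart (Some 0)\<close> is the map from x to [1 : x]. Since every other chart is
  its translate, facts about \<open>base_ball\<close> transfer to all residue classes.\<close>

lemma proj_act_chart_matrix:
  assumes "chart_index c"
  shows "proj_act (chart_matrix c) (chart (Some 0) x) = chart c x"
proof -
  have "chart_matrix c *v vector [1, x] = (case c of None \<Rightarrow> vector [x, 1] | Some t \<Rightarrow> vector [1, t + x])"
    by (cases c) (simp_all add: vec_eq_iff forall_2 matrix_vector_mult_2)
  moreover have "proj_act (chart_matrix c) (chart (Some 0) x) = proj (chart_matrix c *v vector [1, x])"
    by (simp add: proj_act_proj[OF chart_matrix_GL2[OF assms]] chart_vector_nonzero)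
  ultimately show ?thesis by (cases c) simp_all
qed

lemma chart_slope:
  assumes "p \<in> base_ball"
  shows "slope p \<in> max_ideal" "chart (Some 0) (slope p) = p"
proof -
  obtain x where x: "x \<noteq> 0" "p = proj x" by (rule proj_cases)
  then have lt: "absv (x $ 2) < absv (x $ 1)" using assms by (simp add: proj_in_base_ball)
  then have nz: "x $ 1 \<noteq> 0" using absv_nonneg[of "x $ 2"] by auto
  have s: "x $ 2 = slope p * x $ 1" using x assms nz by (simp add: slope_proj)
  then show "slope p \<in> max_ideal" using lt absv_pos[OF nz] by (simp add: max_ideal_def absv_mult)
  have "x = x $ 1 *s vector [1, slope p]" using s by (simp add: vec_eq_iff forall_2 mult.commute)
  then show "chart (Some 0) (slope p) = p"
    using nz x by (auto simp: proj_eq_iff chart_vector_nonzero)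
qed

lemma slope_chart:
  assumes "x \<in> max_ideal"
  shows "chart (Some 0) x \<in> base_ball" "slope (chart (Some 0) x) = x"
  using assms by (simp_all add: proj_in_base_ball slope_proj chart_vector_nonzero max_ideal_def)

lemma proj_act_inverse_chart:
  assumes "chart_index c"
  shows "proj_act (chart_matrix (map_option uminus c)) (chart c x) = chart (Some 0) x"
  using assms
  by (simp add: proj_act_cancel chart_matrix_GL2 chart_index_uminus chart_matrix_inverse
      flip: proj_act_chart_matrix)

lemma chart_coord_chart:
  assumes "chart_index c" "x \<in> max_ideal"
  shows "chart c x \<in> chart_ball c" "chart_coord c (chart c x) = x"
  using assms slope_chart[of x]
  by (simp_all add: chart_ball_def chart_coord_def proj_act_inverse_chart del: chart.simps)

lemma chart_chart_coord:
  assumes c: "chart_index c" and "p \<in> chart_ball c"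
  shows "chart_coord c p \<in> max_ideal" "chart c (chart_coord c p) = p"
proof -
  have "chart c (chart_coord c p) = proj_act (chart_matrix c) (chart (Some 0) (chart_coord c p))"
    by (rule proj_act_chart_matrix[OF c, symmetric])
  also have "\<dots> = p"
    using assms by (simp add: chart_ball_def chart_coord_def chart_slope proj_act_cancel chart_matrix_GL2
      chart_index_uminus chart_matrix_inverse del: chart.simps)
  finally show "chart c (chart_coord c p) = p" .
qed (use assms in \<open>simp add: chart_ball_def chart_coord_def chart_slope\<close>)

lemma borel_measurable_chart_coord:
  "chart_index c \<Longrightarrow> chart_coord c \<in> borel_measurable borel"
  unfolding chart_coord_def
  by (intro measurable_compose[OF measurable_proj_act borel_measurable_slope] chart_matrix_GL2)
    (simp add: chart_index_uminus)

lemma chart_ball_borel: "chart_index c \<Longrightarrow> chart_ball c \<in> sets borel"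
  unfolding chart_ball_def
  using measurable_sets[OF measurable_proj_act[OF chart_matrix_GL2] base_ball_borel, of "map_option uminus c"]
  by (simp add: vimage_def chart_index_uminus)

lemma borel_measurable_chart:
  "chart c \<in> borel_measurable (borel :: 'k::nonarch_valued_field measure)"
proof (rule borel_measurableI)
  fix U :: "'k proj_line set" assume "open U"
  define v :: "'k \<Rightarrow> 'k ^ 2"
    where "v x = (case c of None \<Rightarrow> vector [x, 1] | Some t \<Rightarrow> vector [1, t + x])" for x
  have v: "v x \<noteq> 0" "chart c x = proj (v x)" for x
    by (cases c; simp add: v_def chart_vector_nonzero)+
  have "continuous_on UNIV (\<lambda>x. v x $ 1)" "continuous_on UNIV (\<lambda>x. v x $ 2)"
    by (cases c; simp add: v_def continuous_intros)+
  then have "continuous_on UNIV (\<lambda>x. v x $ i)" for i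
    using exhaust_2[of i] by auto
  then have "continuous_on UNIV (\<lambda>x. \<chi> i. v x $ i)" by (rule continuous_on_vec_lambda)
  then have "open (v -` {y. y \<noteq> 0 \<and> proj y \<in> U})"
    using \<open>open U\<close> by (intro open_vimage) (simp_all flip: open_proj_line_iff)
  also have "v -` {y. y \<noteq> 0 \<and> proj y \<in> U} = chart c -` U" by (auto simp: v)
  finally show "chart c -` U \<inter> space borel \<in> sets borel" by simp
qed

section \<open>Spherical distance in the charts\<close>

lemma sph_dist_chart_Some:
  assumes "absv s \<le> 1" "absv t \<le> 1" "x \<in> max_ideal" "y \<in> max_ideal"
  shows "sph_dist (chart (Some s) x) (chart (Some t) y) = absv ((s - t) + (x - y))"
proof -
  \<comment> \<open>Both coordinate vectors have maximum norm 1, so only the determinant remains.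
    For \<open>s = t\<close> it gives the isometry with P; for distinct residues
    \<open>s - t\<close> dominates.\<close>
  have "absv (s + x) \<le> 1" "absv (t + y) \<le> 1"
    using assms absv_ultrametric[of s x] absv_ultrametric[of t y] by (auto simp: max_ideal_def)
  moreover have "absv ((t + y) - (s + x)) = absv ((s - t) + (x - y))"
    using absv_diff_commute[of "t + y" "s + x"] by (simp add: algebra_simps)
  ultimately show ?thesis
    by (simp add: sph_dist_proj chart_vector_nonzero max_absorb1)
qed

text \<open>The determinant is \<open>x * (t + y) - 1\<close>, up to sign, and its first term has
  absolute value less than 1, so the term 1 dominates.\<close>

lemma sph_dist_chart_None_Some:
  assumes "absv t \<le> 1" "x \<in> max_ideal" "y \<in> max_ideal"
  shows "sph_dist (chart None x) (chart (Some t) y) = 1" "sph_dist (chart (Some t) y) (chart None x) = 1"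
proof -
  have t: "absv (t + y) \<le> 1"
    using assms absv_ultrametric[of t y] by (auto simp: max_ideal_def)
  have x: "absv x < 1" using assms(2) by (simp add: max_ideal_def)
  have "absv (x * (t + y)) \<le> absv x" using t mult_left_mono[OF t, of "absv x"] by (simp add: absv_mult)
  then have "absv (1 + - (x * (t + y))) = 1" using absv_add_eq[of "- (x * (t + y))" 1] x by simp
  then have 1: "absv (1 - x * (t + y)) = 1" by simp
  then have 2: "absv (x * (t + y) - 1) = 1" by (simp add: absv_diff_commute)
  show "sph_dist (chart None x) (chart (Some t) y) = 1" "sph_dist (chart (Some t) y) (chart None x) = 1"
    using t x 1 2 by (simp_all add: sph_dist_proj chart_vector_nonzero max_absorb1 max_absorb2 mult.commute)
qed

lemma sph_dist_chart:
  assumes c: "chart_index c" and x: "x \<in> max_ideal" and y: "y \<in> max_ideal"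
  shows "sph_dist (chart c x) (chart c y) = absv (x - y)"
proof (cases c)
  case None
  then show ?thesis
    using x y by (simp add: sph_dist_proj chart_vector_nonzero max_ideal_def max_absorb2)
next
  case (Some t)
  then show ?thesis
    using c sph_dist_chart_Some[OF _ _ x y, of t t] by (simp add: chart_index_def)
qed

lemma residue_charts:
  obtains C :: "'k::nonarch_local_field option set"
  where "finite C" "card C = residue_card TYPE('k) + 1"
    and "\<And>c. c \<in> C \<Longrightarrow> chart_index c"
    and "\<And>p. \<exists>c\<in>C. p \<in> chart_ball c"
    and "\<And>c d x y. c \<in> C \<Longrightarrow> d \<in> C \<Longrightarrow> c \<noteq> d \<Longrightarrow> x \<in> max_ideal \<Longrightarrow> y \<in> max_ideal \<Longrightarrow>
      sph_dist (chart c x) (chart d y) = 1"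
    and "disjoint_family_on chart_ball C"
proof -
  obtain T :: "'k set" where T: "finite T" "card T = residue_card TYPE('k)"
    "\<And>t. t \<in> T \<Longrightarrow> absv t \<le> 1" "\<And>x. absv x \<le> 1 \<Longrightarrow> \<exists>t\<in>T. x - t \<in> max_ideal"
    "\<And>s t. s \<in> T \<Longrightarrow> t \<in> T \<Longrightarrow> s \<noteq> t \<Longrightarrow> absv (s - t) = 1"
    by (rule residue_representatives[where ?'k = 'k]) blast
  let ?C = "insert None (Some ` T)"
  have index: "chart_index c" if "c \<in> ?C" for c using that T(3) by (auto simp: chart_index_def)
  have dist: "sph_dist (chart c x) (chart d y) = 1"
    if cd: "c \<in> ?C" "d \<in> ?C" "c \<noteq> d" and xy: "x \<in> max_ideal" "y \<in> max_ideal" for c d x y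
  proof (cases c; cases d)
    fix s t assume st: "c = Some s" "d = Some t"
    then have "absv (s - t) = 1" using cd T(5) by auto
    then have "absv ((s - t) + (x - y)) = 1"
      using absv_add_eq[of "x - y" "s - t"] max_ideal_diff[OF xy] by (simp add: max_ideal_def)
    then show ?thesis using sph_dist_chart_Some[OF _ _ xy, of s t] st cd T(3) by auto
  next
    fix s assume "c = Some s" "d = None"
    then show ?thesis using sph_dist_chart_None_Some(2)[OF _ xy(2,1), of s] cd T(3) by auto
  next
    fix t assume "c = None" "d = Some t"
    then show ?thesis using sph_dist_chart_None_Some(1)[OF _ xy, of t] cd T(3) by auto
  qed (use cd in simp)
  show ?thesis
  proof (rule that[of ?C])
    show "finite ?C" using T(1) by simp
    show "card ?C = residue_card TYPE('k) + 1" using T(1,2) by (simp add: card_image card_insert_if image_iff)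
    show "chart_index c" if "c \<in> ?C" for c by (rule index[OF that])
    show "\<exists>c\<in>?C. p \<in> chart_ball c" for p
    proof -
      obtain z where z: "z \<noteq> 0" "p = proj z" by (rule proj_cases)
      show ?thesis
      \<comment> \<open>This is reduction modulo P: the point reduces to [0 : 1] if the first
        coordinate is strictly smaller; otherwise \<open>z $ 2 / z $ 1\<close> lies in R and its
        residue selects \<open>t\<close>.\<close>
      proof (cases "absv (z $ 1) < absv (z $ 2)")
        case True
        then have nz: "z $ 2 \<noteq> 0" using absv_nonneg[of "z $ 1"] by auto
        define x where "x = z $ 1 / z $ 2"
        have zx: "z $ 1 = x * z $ 2" using nz by (simp add: x_def)
        then have x: "x \<in> max_ideal" using True absv_pos[OF nz] by (simp add: max_ideal_def absv_mult)
        have "z = z $ 2 *s vector [x, 1]" using zx by (simp add: vec_eq_iff forall_2 mult.commute)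
        then have "chart None x = p" using nz z by (auto simp: proj_eq_iff chart_vector_nonzero)
        then show ?thesis using chart_coord_chart(1)[of None x] index[of None] x by auto
      next
        case False
        then have nz: "z $ 1 \<noteq> 0" using z by (auto simp: vec_eq_0_iff_2 not_less)
        define u where "u = z $ 2 / z $ 1"
        have zu: "z $ 2 = u * z $ 1" using nz by (simp add: u_def)
        then have "absv u \<le> 1" using False absv_pos[OF nz] by (simp add: absv_mult)
        then obtain t where t: "t \<in> T" "u - t \<in> max_ideal" using T(4) by blast
        have "z = z $ 1 *s vector [1, u]" using zu by (simp add: vec_eq_iff forall_2 mult.commute)
        then have "chart (Some t) (u - t) = p" using nz z by (auto simp: proj_eq_iff chart_vector_nonzero)
        then show ?thesis using chart_coord_chart(1)[OF index[of "Some t"] t(2)] t(1) by auto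
      qed
    qed
  show "sph_dist (chart c x) (chart d y) = 1"
      if "c \<in> ?C" "d \<in> ?C" "c \<noteq> d" "x \<in> max_ideal" "y \<in> max_ideal" for c d x y
      by (rule dist[OF that])
    show "disjoint_family_on chart_ball ?C"
    proof (unfold disjoint_family_on_def, intro ballI impI, rule ccontr)
      fix c d assume cd: "c \<in> ?C" "d \<in> ?C" "c \<noteq> d" "chart_ball c \<inter> chart_ball d \<noteq> {}"
      then obtain p where p: "p \<in> chart_ball c" "p \<in> chart_ball d" by auto
      note pc = chart_chart_coord[OF index[OF cd(1)] p(1)] and pd = chart_chart_coord[OF index[OF cd(2)] p(2)]
      \<comment> \<open>A point in two different balls would have distance 1 to itself, but the
        isometry of a single chart gives 0.\<close>
      have "sph_dist p p = 1" using dist[OF cd(1-3) pc(1) pd(1)] pc(2) pd(2) by simp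
      moreover have "sph_dist p p = 0" using sph_dist_chart[OF index[OF cd(1)] pc(1) pc(1)] pc(2) by simp
      ultimately show False by simp
    qed
  qed
qed

lemma sph_dist_le_1: "sph_dist p r \<le> (1::real)" for p r :: "'k::nonarch_local_field proj_line"
proof -
  obtain C :: "'k option set" where C: "\<And>c. c \<in> C \<Longrightarrow> chart_index c" "\<And>p. \<exists>c\<in>C. p \<in> chart_ball c"
    "\<And>c d x y. c \<in> C \<Longrightarrow> d \<in> C \<Longrightarrow> c \<noteq> d \<Longrightarrow> x \<in> max_ideal \<Longrightarrow> y \<in> max_ideal \<Longrightarrow>
      sph_dist (chart c x) (chart d y) = 1"
    by (rule residue_charts) blast
  obtain c d where cd: "c \<in> C" "p \<in> chart_ball c" "d \<in> C" "r \<in> chart_ball d" using C(2) by blast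
  note p = chart_chart_coord[OF C(1)[OF cd(1)] cd(2)] and r = chart_chart_coord[OF C(1)[OF cd(3)] cd(4)]
  show ?thesis
  proof (cases "c = d")
    case True
    then show ?thesis
      using sph_dist_chart[OF C(1)[OF cd(1)] p(1) r(1)[folded True]] max_ideal_diff[OF p(1) r(1)] p(2) r(2)
      by (simp add: max_ideal_def)
  next
    case False
    then show ?thesis using C(3)[OF cd(1,3) False p(1) r(1)] p(2) r(2) by simp
  qed
qed

text \<open>The target is the product of two Borel sigma-algebras, so the function is written as a
  finite sum over pairs of residue balls: in each pair it is the distance of the chart coordinates
  or the constant 1, and by disjointness the indicators select one term.\<close>

lemma borel_measurable_sph_dist:
  "case_prod sph_dist \<in> borel_measurable (borel \<Otimes>\<^sub>M (borel :: 'k::nonarch_local_field proj_line measure))"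
proof -
  obtain C :: "'k option set" where C: "finite C" "\<And>c. c \<in> C \<Longrightarrow> chart_index c"
    "\<And>p. \<exists>c\<in>C. p \<in> chart_ball c"
    "\<And>c d x y. c \<in> C \<Longrightarrow> d \<in> C \<Longrightarrow> c \<noteq> d \<Longrightarrow> x \<in> max_ideal \<Longrightarrow> y \<in> max_ideal \<Longrightarrow>
      sph_dist (chart c x) (chart d y) = 1" "disjoint_family_on chart_ball C"
    by (rule residue_charts) blast
  define g where "g c d p r = (if c = d then absv (chart_coord c p - chart_coord c r) else 1)"
    for c d and p r :: "'k proj_line"
  have "sph_dist p r = (\<Sum>c\<in>C. \<Sum>d\<in>C. indicator (chart_ball c) p * (indicator (chart_ball d) r * g c d p r))"
    for p r
  proof -
    obtain c d where cd: "c \<in> C" "p \<in> chart_ball c" "d \<in> C" "r \<in> chart_ball d" using C(3) by blast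
    note p = chart_chart_coord[OF C(2)[OF cd(1)] cd(2)] and r = chart_chart_coord[OF C(2)[OF cd(3)] cd(4)]
    have ind: "indicator (chart_ball e) s = (if e = e' then 1 else 0 :: real)"
      if "e \<in> C" "e' \<in> C" "s \<in> chart_ball e'" for e e' s
      using C(5) that by (auto simp: disjoint_family_on_def indicator_def)
    have "(\<Sum>c'\<in>C. \<Sum>d'\<in>C. indicator (chart_ball c') p * (indicator (chart_ball d') r * g c' d' p r)) =
      (\<Sum>c'\<in>C. \<Sum>d'\<in>C. (if c' = c then 1 else 0) * ((if d' = d then 1 else 0) * g c' d' p r))"
      using cd by (intro sum.cong refl arg_cong2[where f = "(*)"] ind) auto
    also have "\<dots> = (\<Sum>c'\<in>C. if c' = c then g c' d p r else 0)"
      using C(1) cd by (intro sum.cong refl) (simp add: mult_delta_left sum.delta)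
    also have "\<dots> = g c d p r" using C(1) cd by (simp add: sum.delta)
    also have "\<dots> = sph_dist p r"
    proof (cases "c = d")
      case True
      then show ?thesis
        using sph_dist_chart[OF C(2)[OF cd(1)] p(1) r(1)[folded True]] p(2) r(2) by (simp add: g_def)
    next
      case False
      then show ?thesis using C(4)[OF cd(1,3) False p(1) r(1)] p(2) r(2) by (simp add: g_def)
    qed
    finally show ?thesis by simp
  qed
  moreover have "(\<lambda>x. \<Sum>c\<in>C. \<Sum>d\<in>C. indicator (chart_ball c) (fst x) *
      (indicator (chart_ball d) (snd x) * g c d (fst x) (snd x)))
      \<in> borel_measurable (borel \<Otimes>\<^sub>M (borel :: 'k proj_line measure))"
  proof (intro borel_measurable_sum)
    fix c d assume "c \<in> C" "d \<in> C"
    note [measurable] = chart_ball_borel[OF C(2)[OF \<open>c \<in> C\<close>]] chart_ball_borel[OF C(2)[OF \<open>d \<in> C\<close>]]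
      borel_measurable_chart_coord[OF C(2)[OF \<open>d \<in> C\<close>]]
    show "(\<lambda>x. indicator (chart_ball c) (fst x) * (indicator (chart_ball d) (snd x) * g c d (fst x) (snd x)))
      \<in> borel_measurable (borel \<Otimes>\<^sub>M (borel :: 'k proj_line measure))"
      by (cases "c = d") (simp_all add: g_def flip: dist_absv, measurable)
  qed
  ultimately show ?thesis by (simp add: case_prod_beta')
qed

section \<open>The invariant measure on a residue class\<close>

lemma invariant_prob_measure:
  assumes "invariant_prob \<nu>"
  shows "sets \<nu> = sets borel" "space \<nu> = UNIV" "emeasure \<nu> UNIV = 1" "finite_measure \<nu>"
proof -
  show s: "sets \<nu> = sets borel" using assms by (simp add: invariant_prob_def)
  show sp: "space \<nu> = UNIV" using sets_eq_imp_space_eq[OF s] by simp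
  show "emeasure \<nu> UNIV = 1" using assms by (simp add: invariant_prob_def sp)
  then show "finite_measure \<nu>" by (intro finite_measureI) (simp add: sp)
qed

text \<open>The slope carries \<nu> on \<open>base_ball\<close> to a measure on P that is invariant
  under translation by P, like \<mu> restricted to P. By uniqueness the two are proportional; the
  total masses are cross-multiplied, as in \<open>max_ideal_invariant_unique\<close>.\<close>

lemma nn_integral_base_ball:
  fixes \<mu> :: "'k::nonarch_local_field measure"
  assumes \<mu>: "normalized_haar \<mu>" and \<nu>: "invariant_prob \<nu>" and f: "f \<in> borel_measurable borel"
  shows "(\<integral>\<^sup>+p. f p * indicator base_ball p \<partial>\<nu>) * emeasure \<mu> max_ideal =
    emeasure \<nu> base_ball * (\<integral>\<^sup>+x. f (chart (Some 0) x) * indicator max_ideal x \<partial>\<mu>)"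
proof -
  have s\<mu>: "sets \<mu> = sets borel" using \<mu> by (simp add: normalized_haar_def)
  note s\<nu> = invariant_prob_measure[OF \<nu>]
  note [measurable_cong] = s\<mu> s\<nu>(1)
  have sp\<mu>: "space \<mu> = UNIV" using sets_eq_imp_space_eq[OF s\<mu>] by simp
  define m1 where "m1 = distr (density \<nu> (indicator base_ball)) borel slope"
  define m2 where "m2 = density \<mu> (indicator max_ideal)"
  have m1: "emeasure m1 S = emeasure \<nu> (base_ball \<inter> slope -` S)" if [measurable]: "S \<in> sets borel" for S
  proof -
    have "slope -` S \<in> sets \<nu>" using measurable_sets[OF borel_measurable_slope that] by (simp add: s\<nu>)
    then show ?thesis
      unfolding m1_def by (subst emeasure_distr) (auto simp: emeasure_restricted s\<nu>)
  qed
  have m2: "emeasure m2 S = emeasure \<mu> (max_ideal \<inter> S)" if "S \<in> sets borel" for S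
    unfolding m2_def by (rule emeasure_restricted) (use that in \<open>simp_all add: s\<mu>\<close>)
  have sets: "sets m1 = sets borel" "sets m2 = sets borel" by (simp_all add: m1_def m2_def s\<mu>)
  have sp: "space m1 = UNIV" "space m2 = UNIV" using sets[THEN sets_eq_imp_space_eq] by auto
  have u: "emeasure m1 UNIV = emeasure \<nu> base_ball" "emeasure m2 UNIV = emeasure \<mu> max_ideal"
    by (simp_all add: m1 m2)
  have fin1: "finite_measure m1"
    using emeasure_mono[of base_ball UNIV \<nu>] by (intro finite_measureI) (auto simp: sp u s\<nu> top_unique)
  have fin2: "finite_measure m2"
    using emeasure_max_ideal_le_1[OF \<mu>] by (intro finite_measureI) (auto simp: sp u top_unique)
  have unique: "emeasure m1 S * emeasure m2 UNIV = emeasure m2 S * emeasure m1 UNIV"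
    if S: "S \<in> sets borel" for S
  proof (rule max_ideal_invariant_unique[OF fin1 fin2 sets _ _ _ _ S])
    show "AE x in m1. x \<in> max_ideal"
      unfolding m1_def by (subst AE_distr_iff) (auto simp: AE_density indicator_def chart_slope(1) intro!: AE_I2)
    show "AE x in m2. x \<in> max_ideal"
      unfolding m2_def by (subst AE_density) (auto simp: indicator_def intro!: AE_I2)
    fix y :: 'k and S :: "'k set"
    assume y: "y \<in> max_ideal" and S[measurable]: "S \<in> sets borel"
    have S': "{x. x + y \<in> S} \<in> sets borel" by measurable
    \<comment> \<open>The shear with parameter \<open>y\<close> sends [1 : x] to [1 : x + y], so
      translation of slopes comes from an element of \<open>GL2_int\<close>.\<close>
    let ?A = "chart_matrix (Some y)"
    have A: "?A \<in> GL2_int" using y by (intro chart_matrix_GL2) (simp add: chart_index_def max_ideal_def)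
    have "proj_act ?A p \<in> base_ball \<inter> slope -` S \<longleftrightarrow> p \<in> base_ball \<inter> slope -` {x. x + y \<in> S}" for p
    proof -
      obtain x where x: "x \<noteq> 0" "p = proj x" by (rule proj_cases)
      have Ax: "(?A *v x) $ 1 = x $ 1" "(?A *v x) $ 2 = x $ 2 + y * x $ 1"
        by (simp_all add: matrix_vector_mult_2 add.commute)
      have act: "proj_act ?A p = proj (?A *v x)" "?A *v x \<noteq> 0"
        using x A proj_act_proj GL2_int_mult_nonzero by blast+
      \<comment> \<open>Since \<open>y\<close> is in P, the shear adds to \<open>x $ 2\<close> a
        term smaller than \<open>x $ 1\<close>, so it preserves \<open>base_ball\<close>.\<close>
      have iff: "absv (x $ 2 + y * x $ 1) < absv (x $ 1) \<longleftrightarrow> absv (x $ 2) < absv (x $ 1)"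
      proof (cases "x $ 1 = 0")
        case False
        then have "absv (y * x $ 1) < absv (x $ 1)"
          using y absv_pos[OF False] by (simp add: absv_mult max_ideal_def)
        then show ?thesis
          using absv_ultrametric[of "x $ 2" "y * x $ 1"]
            absv_diff_ultrametric[of "x $ 2 + y * x $ 1" "y * x $ 1"] by auto
      qed simp
      have "slope (proj_act ?A p) = slope p + y" if "absv (x $ 2) < absv (x $ 1)"
      proof -
        have "x $ 1 \<noteq> 0" using that by auto
        moreover have "proj (?A *v x) \<in> base_ball" "proj x \<in> base_ball"
          using that iff x act(2) by (simp_all add: proj_in_base_ball Ax del: chart_matrix.simps)
        ultimately show ?thesis using x act by (simp add: slope_proj Ax field_simps del: chart_matrix.simps)
      qed
      then show ?thesis using iff x act by (auto simp: proj_in_base_ball Ax simp del: chart_matrix.simps)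
    qed
    then have "base_ball \<inter> slope -` {x. x + y \<in> S} = {p. proj_act ?A p \<in> base_ball \<inter> slope -` S}" by blast
    moreover have "base_ball \<inter> slope -` S \<in> sets borel"
      using measurable_sets[OF borel_measurable_slope S] by (simp add: sets.Int)
    ultimately show "emeasure m1 {x. x + y \<in> S} = emeasure m1 S"
      by (simp only: m1[OF S'] m1[OF S] emeasure_vimage_proj_act[OF \<nu> A])
    have "max_ideal \<inter> {x. x + y \<in> S} = {x. x + y \<in> max_ideal \<inter> S}"
      using max_ideal_add_cancel[OF y] by auto
    then show "emeasure m2 {x. x + y \<in> S} = emeasure m2 S"
      by (simp add: m2 S' normalized_haar_translate[OF \<mu>] del: Int_iff)
  qed
  \<comment> \<open>Proportionality as an equality of measures, so that it applies to integrals of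
    arbitrary functions.\<close>
  have "scale_measure (emeasure m2 UNIV) m1 = scale_measure (emeasure m1 UNIV) m2"
    by (rule measure_eqI) (auto simp: sets unique mult.commute)
  then have "(\<integral>\<^sup>+x. f (chart (Some 0) x) \<partial>scale_measure (emeasure m2 UNIV) m1) =
      (\<integral>\<^sup>+x. f (chart (Some 0) x) \<partial>scale_measure (emeasure m1 UNIV) m2)" by simp
  moreover have fc[measurable]: "(\<lambda>x. f (chart (Some 0) x)) \<in> borel_measurable borel"
    by (rule measurable_compose[OF borel_measurable_chart f])
  moreover have "(\<integral>\<^sup>+x. f (chart (Some 0) x) \<partial>m1) = (\<integral>\<^sup>+p. f p * indicator base_ball p \<partial>\<nu>)"
  proof -
    have "(\<integral>\<^sup>+x. f (chart (Some 0) x) \<partial>m1) = (\<integral>\<^sup>+p. indicator base_ball p * f (chart (Some 0) (slope p)) \<partial>\<nu>)"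
      unfolding m1_def by (simp add: nn_integral_distr nn_integral_density fc del: chart.simps)
    also have "\<dots> = (\<integral>\<^sup>+p. f p * indicator base_ball p \<partial>\<nu>)"
      by (intro nn_integral_cong) (simp add: chart_slope indicator_def del: chart.simps)
    finally show ?thesis .
  qed
  moreover have "(\<integral>\<^sup>+x. f (chart (Some 0) x) \<partial>m2) = (\<integral>\<^sup>+x. f (chart (Some 0) x) * indicator max_ideal x \<partial>\<mu>)"
    unfolding m2_def by (simp add: nn_integral_density mult.commute del: chart.simps)
  ultimately show ?thesis
    by (simp add: nn_integral_scale_measure sets u mult.commute cong: measurable_cong_sets del: chart.simps)
qed

text \<open>Substitute the action of \<open>chart_matrix c\<close>: it preserves \<nu> and pulls the
  indicator of the ball back to that of \<open>base_ball\<close>.\<close>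

lemma nn_integral_chart_ball_base:
  assumes \<nu>: "invariant_prob \<nu>" and c: "chart_index c" and f[measurable]: "f \<in> borel_measurable borel"
  shows "(\<integral>\<^sup>+p. f p * indicator (chart_ball c) p \<partial>\<nu>) =
    (\<integral>\<^sup>+p. f (proj_act (chart_matrix c) p) * indicator base_ball p \<partial>\<nu>)"
proof -
  note [measurable] = chart_ball_borel[OF c]
  have "indicator (chart_ball c) (proj_act (chart_matrix c) p) = (indicator base_ball p :: ennreal)" for p
    by (simp add: indicator_def chart_ball_def proj_act_cancel chart_matrix_GL2 chart_index_uminus c
        chart_matrix_inverse)
  then show ?thesis
    using nn_integral_proj_act[OF \<nu> chart_matrix_GL2[OF c], of "\<lambda>p. f p * indicator (chart_ball c) p"]
    by simp
qed

text \<open>The q + 1 residue balls partition the projective line and, by invariance, all have the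
  mass of \<open>base_ball\<close>.\<close>

lemma emeasure_base_ball:
  fixes \<nu> :: "'k::nonarch_local_field proj_line measure"
  assumes \<nu>: "invariant_prob \<nu>"
  shows "of_nat (residue_card TYPE('k) + 1) * emeasure \<nu> base_ball = 1"
proof -
  obtain C :: "'k option set" where C: "finite C" "card C = residue_card TYPE('k) + 1"
    "\<And>c. c \<in> C \<Longrightarrow> chart_index c" "\<And>p. \<exists>c\<in>C. p \<in> chart_ball c" "disjoint_family_on chart_ball C"
    by (rule residue_charts) blast
  note s = invariant_prob_measure[OF \<nu>]
  have "emeasure \<nu> (chart_ball c) = emeasure \<nu> base_ball" if "c \<in> C" for c
    using nn_integral_chart_ball_base[OF \<nu> C(3)[OF that], of "\<lambda>_. 1"] chart_ball_borel[OF C(3)[OF that]]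
    by (simp add: s)
  then have "of_nat (card C) * emeasure \<nu> base_ball = (\<Sum>c\<in>C. emeasure \<nu> (chart_ball c))" by simp
  also have "\<dots> = emeasure \<nu> (\<Union>c\<in>C. chart_ball c)"
    using C chart_ball_borel by (intro sum_emeasure) (auto simp: s)
  also have "(\<Union>c\<in>C. chart_ball c) = UNIV" using C(4) by blast
  finally show ?thesis by (simp only: C(2) s)
qed

text \<open>The constant is the ratio of the masses of \<open>base_ball\<close> and P, namely (1/(q
  + 1)) / (1/q).\<close>

lemma nn_integral_chart_ball:
  fixes \<mu> :: "'k::nonarch_local_field measure"
  assumes \<mu>: "normalized_haar \<mu>" and \<nu>: "invariant_prob \<nu>" and c: "chart_index c"
    and f: "f \<in> borel_measurable borel" and q: "q = residue_card TYPE('k)"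
  shows "(\<integral>\<^sup>+p. f p * indicator (chart_ball c) p \<partial>\<nu>) =
    ennreal (real q / (real q + 1)) * (\<integral>\<^sup>+x. f (chart c x) \<partial>restrict_space \<mu> max_ideal)"
proof -
  have s: "sets \<mu> = sets borel" using \<mu> by (simp add: normalized_haar_def)
  let ?X = "\<integral>\<^sup>+p. f p * indicator (chart_ball c) p \<partial>\<nu>"
  let ?Y = "\<integral>\<^sup>+x. f (chart c x) * indicator max_ideal x \<partial>\<mu>"
  have "(\<lambda>p. f (proj_act (chart_matrix c) p)) \<in> borel_measurable borel"
    by (rule measurable_compose[OF measurable_proj_act[OF chart_matrix_GL2[OF c]] f])
  from nn_integral_base_ball[OF \<mu> \<nu> this]
  have XY: "?X * emeasure \<mu> max_ideal = emeasure \<nu> base_ball * ?Y"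
    by (simp only: nn_integral_chart_ball_base[OF \<nu> c f] proj_act_chart_matrix[OF c])
  have "of_nat q * emeasure \<nu> base_ball = ennreal (real q / (real q + 1))"
  proof -
    have "ennreal (real (q + 1)) * ennreal (1 / (real q + 1)) = ennreal (real (q + 1) * (1 / (real q + 1)))"
      by (rule ennreal_mult[symmetric]) simp_all
    also have "\<dots> = of_nat (q + 1) * emeasure \<nu> base_ball"
      unfolding q emeasure_base_ball[OF \<nu>] by (simp add: add.commute)
    finally have "emeasure \<nu> base_ball = ennreal (1 / (real q + 1))"
      by (simp add: ennreal_mult_cancel_left ennreal_of_nat_eq_real_of_nat)
    then show ?thesis by (simp add: ennreal_of_nat_eq_real_of_nat flip: ennreal_mult')
  qed
  \<comment> \<open>Multiplying by \<open>q\<close> replaces division by the mass of P, because the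
    product of the two is 1.\<close>
  moreover have "?X = of_nat q * (?X * emeasure \<mu> max_ideal)"
    by (simp only: q mult.left_commute[of _ ?X] emeasure_max_ideal[OF \<mu>] mult_1_right)
  moreover have "?Y = (\<integral>\<^sup>+x. f (chart c x) \<partial>restrict_space \<mu> max_ideal)"
    by (rule nn_integral_restrict_space[symmetric]) (simp add: s sets.Int_space_eq2)
  ultimately show ?thesis unfolding XY by (simp flip: mult.assoc)
qed

section \<open>The power law\<close>

theorem theorem2p3:
  fixes \<mu> :: "'k::nonarch_local_field measure"
    and \<nu> :: "'k proj_line measure"
    and \<beta> :: real
    and q :: nat
  assumes "normalized_haar \<mu>"
    and "invariant_prob \<nu>"
    and "q = residue_card TYPE('k)"
    and "\<beta> > 0"
  shows "(\<forall>f. summable (\<lambda>N. complex_of_real (Z_line \<nu> \<beta> N) * (f ^ N / fact N))) \<and>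
    (\<forall>f. summable (\<lambda>N. complex_of_real (Z_ball \<mu> \<beta> N) * (f ^ N / fact N))) \<and>
    grand_fps (Z_line \<nu> \<beta>) =
      (grand_fps (Z_ball \<mu> \<beta>) oo (fps_const (of_nat q / (of_nat q + 1)) * fps_X)) ^ (q + 1) \<and>
    (\<forall>f. grand_Z (Z_line \<nu> \<beta>) f =
      grand_Z (Z_ball \<mu> \<beta>) (of_nat q * f / (of_nat q + 1)) ^ (q + 1))"
proof -
  note \<mu> = assms(1) and \<nu> = assms(2) and q = assms(3)
  note s\<nu> = invariant_prob_measure[OF \<nu>]
  have s\<mu>: "sets \<mu> = sets borel" using \<mu> by (simp add: normalized_haar_def)
  have sp\<mu>: "space \<mu> = UNIV" using sets_eq_imp_space_eq[OF s\<mu>] by simp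
  define \<rho> where "\<rho> = restrict_space \<mu> max_ideal"
  define k where "k p r = sph_dist p r powr \<beta>" for p r :: "'k proj_line"
  define l where "l x y = absv (x - y) powr \<beta>" for x y :: 'k
  let ?k = "\<lambda>p r. ennreal (k p r)" and ?l = "\<lambda>x y. ennreal (l x y)"
  define a where "a = real q / (real q + 1)"

  have \<nu>_sf: "sigma_finite_measure \<nu>"
    using s\<nu>(4) by (simp add: finite_measure_def)
  have sp\<rho>: "space \<rho> = max_ideal" by (simp add: \<rho>_def space_restrict_space sp\<mu>)
  have \<rho>_le: "emeasure \<rho> (space \<rho>) \<le> 1"
  proof -
    have "emeasure \<rho> (space \<rho>) = emeasure \<mu> max_ideal"
      unfolding sp\<rho> by (simp add: \<rho>_def emeasure_restrict_space s\<mu>)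
    then show ?thesis using emeasure_max_ideal_le_1[OF \<mu>] by simp
  qed
  then have "finite_measure \<rho>" by (intro finite_measureI) (auto simp: top_unique)
  then have \<rho>_sf: "sigma_finite_measure \<rho>" by (simp add: finite_measure_def)
  have id\<rho>: "(\<lambda>x. x) \<in> measurable \<rho> borel"
    unfolding \<rho>_def by (rule measurable_restrict_space1) (simp add: measurable_ident_sets s\<mu>)

  have k_meas: "case_prod k \<in> borel_measurable (\<nu> \<Otimes>\<^sub>M \<nu>)"
  proof -
    have "case_prod sph_dist \<in> borel_measurable (\<nu> \<Otimes>\<^sub>M \<nu>)"
      using borel_measurable_sph_dist by (simp add: s\<nu>(1) cong: measurable_cong_sets sets_pair_measure_cong)
    then show ?thesis by (simp add: k_def case_prod_beta')
  qed
  have l_meas: "case_prod l \<in> borel_measurable (\<rho> \<Otimes>\<^sub>M \<rho>)"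
  proof -
    have "(\<lambda>x. dist (fst x) (snd x) powr \<beta>) \<in> borel_measurable (\<rho> \<Otimes>\<^sub>M \<rho>)"
      by (intro powr_real_measurable borel_measurable_dist borel_measurable_const
        measurable_compose[OF measurable_fst id\<rho>] measurable_compose[OF measurable_snd id\<rho>])
    then show ?thesis by (simp add: l_def dist_absv case_prod_beta')
  qed
  have k_meas': "case_prod ?k \<in> borel_measurable (\<nu> \<Otimes>\<^sub>M \<nu>)"
    using measurable_compose[OF k_meas measurable_ennreal] by (simp add: case_prod_beta')
  have l_meas': "case_prod ?l \<in> borel_measurable (\<rho> \<Otimes>\<^sub>M \<rho>)"
    using measurable_compose[OF l_meas measurable_ennreal] by (simp add: case_prod_beta')
  have k_le: "?k p r \<le> 1" for p r
  proof -
    have "0 \<le> sph_dist p r" for p r :: "'k proj_line" by transfer (auto intro!: divide_nonneg_nonneg mult_nonneg_nonneg simp: le_max_iff_disj)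
    then show ?thesis using sph_dist_le_1[of p r] assms(4) by (simp add: k_def powr_le1)
  qed
  have l_le: "?l x y \<le> 1" if "x \<in> space \<rho>" "y \<in> space \<rho>" for x y
    using max_ideal_diff[of x y] that assms(4) by (simp add: l_def sp\<rho> powr_le1 max_ideal_def)

  have Zl: "Z_line \<nu> \<beta> n = enn2real (part_int \<nu> ?k n (\<lambda>_. 1))" for n
    using integral_PiM_eq_part_int[OF \<nu>_sf k_meas, of n] by (simp add: Z_line_def k_def)
  have Zb: "Z_ball \<mu> \<beta> n = enn2real (part_int \<rho> ?l n (\<lambda>_. 1))" for n
    using integral_PiM_eq_part_int[OF \<rho>_sf l_meas, of n] by (simp add: Z_ball_def l_def \<rho>_def)
  have Zl_le: "0 \<le> Z_line \<nu> \<beta> n" "Z_line \<nu> \<beta> n \<le> 1" for n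
    using part_int_le_1[of \<nu> ?k "\<lambda>_. 1" n] k_le s\<nu> by (simp_all add: Zl enn2real_leI)
  have Zb_le: "0 \<le> Z_ball \<mu> \<beta> n" "Z_ball \<mu> \<beta> n \<le> 1" for n
    using part_int_le_1[of \<rho> ?l "\<lambda>_. 1" n] l_le \<rho>_le by (simp_all add: Zb enn2real_leI)

  obtain C :: "'k option set" where C: "finite C" "card C = q + 1"
    "\<And>c. c \<in> C \<Longrightarrow> chart_index c" "\<And>p. \<exists>c\<in>C. p \<in> chart_ball c"
    "\<And>c d x y. c \<in> C \<Longrightarrow> d \<in> C \<Longrightarrow> c \<noteq> d \<Longrightarrow> x \<in> max_ideal \<Longrightarrow> y \<in> max_ideal \<Longrightarrow>
      sph_dist (chart c x) (chart d y) = 1"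
    "disjoint_family_on chart_ball C"
    unfolding q by (rule residue_charts) blast
  define F where "F S = Abs_fps (\<lambda>n. complex_of_real (enn2real (part_int \<nu> ?k n (indicator S))) / fact n)" for S
  \<comment> \<open>Substituting a multiple of the variable scales coefficient n by
    \<open>a ^ n\<close>, which is the factor produced by n changes of variable inside one
    ball.\<close>
  define G where "G = grand_fps (Z_ball \<mu> \<beta>) oo (fps_const (of_nat q / (of_nat q + 1)) * fps_X)"
  have a: "of_nat q / (of_nat q + 1) = complex_of_real a" by (simp add: a_def)
  have G_nth: "fps_nth G n = of_real a ^ n * (of_real (Z_ball \<mu> \<beta> n) / fact n)" for n
    by (simp add: G_def a fps_compose_linear grand_fps_def)

  have F_ball: "F (chart_ball c) = G" if "c \<in> C" for c
  proof (rule fps_ext)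
    fix n
    note c = C(3)[OF that]
    have "part_int \<nu> ?k n (\<lambda>p. 1 * indicator (chart_ball c) p) = ennreal a ^ n * part_int \<rho> ?l n (\<lambda>x. 1)"
    proof (rule part_int_chart[OF \<nu>_sf \<rho>_sf k_meas' l_meas'])
      show "chart c \<in> measurable \<rho> \<nu>"
        using measurable_compose[OF id\<rho> borel_measurable_chart] by (simp add: s\<nu>(1) cong: measurable_cong_sets)
      show "(\<integral>\<^sup>+p. f p * indicator (chart_ball c) p \<partial>\<nu>) = ennreal a * (\<integral>\<^sup>+x. f (chart c x) \<partial>\<rho>)"
        if "f \<in> borel_measurable \<nu>" for f
        unfolding \<rho>_def a_def using that
        by (intro nn_integral_chart_ball[OF \<mu> \<nu> c _ q]) (simp add: s\<nu>(1) cong: measurable_cong_sets)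
      show "chart_ball c \<in> sets \<nu>" using chart_ball_borel[OF c] by (simp add: s\<nu>(1))
      show "?k (chart c x) (chart c y) = ?l x y" if "x \<in> space \<rho>" "y \<in> space \<rho>" for x y
        using sph_dist_chart[OF c] that by (simp add: k_def l_def sp\<rho>)
    qed simp
    then have "enn2real (part_int \<nu> ?k n (indicator (chart_ball c))) = a ^ n * Z_ball \<mu> \<beta> n"
      by (simp add: Zb enn2real_mult a_def ennreal_power)
    then show "fps_nth (F (chart_ball c)) n = fps_nth G n" by (simp add: F_def G_nth)
  qed
  have F_Union: "F (\<Union>c\<in>D. chart_ball c) = G ^ card D" if "D \<subseteq> C" for D
    using finite_subset[OF that C(1)] that
  proof (induction D rule: finite_induct)
    case empty
    \<comment> \<open>The empty domain has room for zero points only, so its generating function is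
      the unit of the product.\<close>
    have "part_int \<nu> ?k n (indicator {}) = (if n = 0 then 1 else 0)" for n
      by (cases n) simp_all
    then have "F {} = 1" by (intro fps_ext) (simp add: F_def)
    then show ?case by simp
  next
    case (insert c D)
    have meas: "chart_ball d \<in> sets \<nu>" if "d \<in> C" for d using chart_ball_borel[OF C(3)[OF that]] by (simp add: s\<nu>(1))
    have "F (chart_ball c \<union> (\<Union>d\<in>D. chart_ball d)) = F (chart_ball c) * F (\<Union>d\<in>D. chart_ball d)"
      unfolding F_def
    proof (rule part_int_fps_Un[OF \<nu>_sf _ k_meas' k_le])
      show "chart_ball c \<in> sets \<nu>" "(\<Union>d\<in>D. chart_ball d) \<in> sets \<nu>"
        using insert meas by (auto intro!: sets.finite_UN)
      show "chart_ball c \<inter> (\<Union>d\<in>D. chart_ball d) = {}"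
        using C(6) insert by (fastforce simp: disjoint_family_on_def)
      show "?k p r = 1 \<and> ?k r p = 1" if pr: "p \<in> chart_ball c" "r \<in> (\<Union>d\<in>D. chart_ball d)" for p r
      proof -
        obtain d where d: "d \<in> D" "r \<in> chart_ball d" using pr by auto
        have cd: "c \<in> C" "d \<in> C" "c \<noteq> d" using insert d by auto
        note p = chart_chart_coord[OF C(3)[OF cd(1)] pr(1)] and r = chart_chart_coord[OF C(3)[OF cd(2)] d(2)]
        show ?thesis
          using C(5)[OF cd p(1) r(1)] C(5)[OF cd(2,1) cd(3)[symmetric] r(1) p(1)] p(2) r(2) by (simp add: k_def)
      qed
    qed (simp add: s\<nu>)
    also have "\<dots> = G * G ^ card D" using insert by (simp add: F_ball)
    finally show ?case using insert by simp
  qed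
  have "(\<Union>c\<in>C. chart_ball c) = UNIV" using C(4) by blast
  then have "F UNIV = G ^ (q + 1)" using F_Union[of C] C(2) by simp
  moreover have "F UNIV = grand_fps (Z_line \<nu> \<beta>)"
    by (simp add: F_def grand_fps_def Zl indicator_def)
  ultimately have fps: "grand_fps (Z_line \<nu> \<beta>) = G ^ (q + 1)" by simp

  \<comment> \<open>Coefficients in [0, 1] make the series dominated termwise by the exponential
    series.\<close>
  have summable: "summable (\<lambda>N. complex_of_real (Z N) * (f ^ N / fact N))"
    if "\<And>n. 0 \<le> Z n" "\<And>n. Z n \<le> 1" for Z and f
  proof (rule summable_comparison_test'[where N = 0])
    show "summable (\<lambda>N. norm f ^ N / fact N)"
      using summable_exp[of "norm f"] by (simp add: field_simps)
    show "norm (complex_of_real (Z N) * (f ^ N / fact N)) \<le> norm f ^ N / fact N" for N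
      using that[of N]
      by (simp add: norm_mult norm_divide norm_power divide_right_mono mult_left_le_one_le)
  qed
  \<comment> \<open>With infinite radius of convergence, evaluation commutes with powers at every
    \<open>f\<close>, so the formal identity yields the identity of functions.\<close>
  have G_radius: "fps_conv_radius G = \<infinity>"
    unfolding fps_conv_radius_def
  proof (rule conv_radius_inftyI'')
    fix f :: complex
    show "summable (\<lambda>n. fps_nth G n * f ^ n)"
      using summable[of "Z_ball \<mu> \<beta>" "of_real a * f"] Zb_le by (simp add: G_nth power_mult_distrib ac_simps)
  qed
  have "grand_Z (Z_line \<nu> \<beta>) f = grand_Z (Z_ball \<mu> \<beta>) (of_nat q * f / (of_nat q + 1)) ^ (q + 1)" for f
  proof -
    have "grand_Z (Z_line \<nu> \<beta>) f = eval_fps (grand_fps (Z_line \<nu> \<beta>)) f"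
      by (simp add: grand_Z_def eval_fps_def grand_fps_def)
    also have "\<dots> = eval_fps G f ^ (q + 1)"
      unfolding fps by (rule eval_fps_power) (simp add: G_radius)
    also have "eval_fps G f = grand_Z (Z_ball \<mu> \<beta>) (of_real a * f)"
      by (simp add: grand_Z_def eval_fps_def G_nth power_mult_distrib ac_simps)
    also have "of_real a * f = of_nat q * f / (of_nat q + 1)" by (simp flip: a)
    finally show ?thesis .
  qed
  with fps show ?thesis using summable Zl_le Zb_le unfolding G_def by blast
qed

end
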